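(* Let $\mathcal{H}:\mathsf{M}\to\mathsf{N}$ be a functor with right adjoint $\mathcal{K}$, unit $\eta$ and counit $\xi$; let $\mathcal{C}$ be a comonad on $\mathsf{M}$ and $\mathcal{D}$ a comonad on $\mathsf{N}$; let $\sigma:\mathcal{H}\mathcal{C}\to\mathcal{D}\mathcal{H}$ be a natural transformation such that $(\mathcal{H},\sigma):(\mathsf{M},\mathcal{C})\to(\mathsf{N},\mathcal{D})$ is a colax morphism of comonads. Let $\tau:\mathcal{C}\mathcal{K}\to\mathcal{K}\mathcal{D}$ be the mate of $\sigma$, and let $\sigma':\mathcal{C}^{\vee}\to\mathcal{D}$ be the transformation associated with $\sigma$ by the universal property of the conjugate comonad $\mathcal{C}^{\vee}=\mathcal{H}\mathcal{C}\mathcal{K}$. Assume: (a) the category $\mathsf{M}$ has equalizers of all coreflexive pairs; (b) the functors $\mathcal{C}$ and $\mathcal{H}$ preserve these equalizers; (c) the functor $\mathcal{H}$ is conservative. Then the functors $$\mathcal{H}_{\sigma}:\mathsf{M}_{\mathcal{C}}\rightleftarrows\mathsf{N}_{\mathcal{D}}:\mathcal{K}^{\tau}$$ form an adjoint equivalence if and only if the transformation $\sigma':\mathcal{C}^{\vee}\to\mathcal{D}$ is invertible.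
   Context: A functor is conservative if it reflects isomorphisms. A parallel pair $f,g:X\rightrightarrows Y$ is coreflexive if there is $r:Y\to X$ with $rf=\mathrm{id}=rg$. The structure of every comonad is denoted $(\delta,\epsilon)$; $\mathsf{M}_{\mathcal{C}}$ is the category of $\mathcal{C}$-coalgebras. $(\mathcal{H},\sigma)$ is a colax morphism of comonads if $(\delta\mathcal{H})\circ\sigma=(\mathcal{D}\sigma)\circ(\sigma\mathcal{C})\circ(\mathcal{H}\delta)$ and $(\epsilon\mathcal{H})\circ\sigma=\mathcal{H}\epsilon$. The mate of $\sigma$ is $\tau=(\mathcal{K}\mathcal{D}\xi)\circ(\mathcal{K}\sigma\mathcal{K})\circ(\eta\mathcal{C}\mathcal{K})$. The conjugate comonad $\mathcal{C}^{\vee}=\mathcal{H}\mathcal{C}\mathcal{K}$ has comultiplication $(\mathcal{H}\mathcal{C}\eta\mathcal{C}\mathcal{K})\circ(\mathcal{H}\delta\mathcal{K})$ and counit $\xi\circ(\mathcal{H}\epsilon\mathcal{K})$. The transformation $\sigma'$ is the unique one with $(\sigma'\mathcal{H})\circ(\mathcal{H}\mathcal{C}\eta)=\sigma$; explicitly $\sigma'=(\mathcal{D}\xi)\circ(\sigma\mathcal{K})$. The functor $\mathcal{H}_\sigma$ sends $(M,c)$ to $(\mathcal{H}(M),\sigma_M\circ\mathcal{H}(c))$ and acts as $\mathcal{H}$ on morphisms. For a $\mathcal{D}$-coalgebra $(N,d)$, $\mathcal{K}^{\tau}(N,d)$ is the equalizer in $\mathsf{M}_{\mathcal{C}}$ (it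 exists under the present hypotheses) of the pair of morphisms of (cofree) $\mathcal{C}$-coalgebras $$\mathcal{C}\mathcal{K}(N)\xrightarrow{\delta_{\mathcal{K}(N)}}\mathcal{C}\mathcal{C}\mathcal{K}(N)\xrightarrow{\mathcal{C}(\tau_N)}\mathcal{C}\mathcal{K}\mathcal{D}(N)\quad\text{and}\quad\mathcal{C}\mathcal{K}(N)\xrightarrow{\mathcal{C}\mathcal{K}(d)}\mathcal{C}\mathcal{K}\mathcal{D}(N).$$ $\mathcal{K}^\tau$ is right adjoint to $\mathcal{H}_\sigma$: the unit at $(M,c)$ is the unique coalgebra morphism $(M,c)\to\mathcal{K}^\tau\mathcal{H}_\sigma(M,c)$ whose composite with the canonical map to $\mathcal{C}\mathcal{K}\mathcal{H}(M)$ is $\mathcal{C}(\eta_M)\circ c$; the counit at $(N,d)$ is $\mathcal{H}$ of the canonical map $\mathcal{K}^\tau(N,d)\to\mathcal{C}\mathcal{K}(N)$ followed by $\mathcal{H}(\epsilon_{\mathcal{K}(N)})$ and $\xi_N$. *)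

theory Defs
  imports Main
begin

record ('o, 'a) cat =
  Obj :: "'o set"
  Arr :: "'a set"
  Dom :: "'a \<Rightarrow> 'o"
  Cod :: "'a \<Rightarrow> 'o"
  Ide :: "'o \<Rightarrow> 'a"
  Comp :: "'a \<Rightarrow> 'a \<Rightarrow> 'a" (infixl "\<cdot>\<index>" 70)

definition Hom :: "('o, 'a) cat \<Rightarrow> 'o \<Rightarrow> 'o \<Rightarrow> 'a set" where
  "Hom A X Y = {f \<in> Arr A. Dom A f = X \<and> Cod A f = Y}"

locale category =
  fixes A :: "('o, 'a) cat" (structure)
  assumes Dom_in: "f \<in> Arr A \<Longrightarrow> Dom A f \<in> Obj A"
    and Cod_in: "f \<in> Arr A \<Longrightarrow> Cod A f \<in> Obj A"
    and Ide_in: "X \<in> Obj A \<Longrightarrow> Ide A X \<in> Hom A X X"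
    and Comp_in: "f \<in> Hom A X Y \<Longrightarrow> g \<in> Hom A Y Z \<Longrightarrow> g \<cdot> f \<in> Hom A X Z"
    and Comp_Ide: "f \<in> Hom A X Y \<Longrightarrow> f \<cdot> Ide A X = f"
    and Ide_Comp: "f \<in> Hom A X Y \<Longrightarrow> Ide A Y \<cdot> f = f"
    and Comp_assoc: "f \<in> Hom A W X \<Longrightarrow> g \<in> Hom A X Y \<Longrightarrow> h \<in> Hom A Y Z \<Longrightarrow>
                       (h \<cdot> g) \<cdot> f = h \<cdot> (g \<cdot> f)"

definition is_iso :: "('o, 'a) cat \<Rightarrow> 'a \<Rightarrow> bool" where
  "is_iso A f \<longleftrightarrow> f \<in> Arr A \<and>
     (\<exists>g \<in> Hom A (Cod A f) (Dom A f).
        g \<cdot>\<^bsub>A\<^esub> f = Ide A (Dom A f) \<and> f \<cdot>\<^bsub>A\<^esub> g = Ide A (Cod A f))"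

record ('o, 'a, 'p, 'b) funct =
  ob :: "'o \<Rightarrow> 'p"
  ar :: "'a \<Rightarrow> 'b"

definition is_functor :: "('o, 'a) cat \<Rightarrow> ('p, 'b) cat \<Rightarrow> ('o, 'a, 'p, 'b) funct \<Rightarrow> bool" where
  "is_functor A B F \<longleftrightarrow> category A \<and> category B \<and>
     (\<forall>X \<in> Obj A. ob F X \<in> Obj B) \<and>
     (\<forall>f \<in> Arr A. ar F f \<in> Hom B (ob F (Dom A f)) (ob F (Cod A f))) \<and>
     (\<forall>X \<in> Obj A. ar F (Ide A X) = Ide B (ob F X)) \<and>
     (\<forall>f \<in> Arr A. \<forall>g \<in> Arr A. Cod A f = Dom A g \<longrightarrow>
        ar F (g \<cdot>\<^bsub>A\<^esub> f) = ar F g \<cdot>\<^bsub>B\<^esub> ar F f)"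

definition id_funct :: "('o, 'a, 'o, 'a) funct" where
  "id_funct = \<lparr>ob = (\<lambda>X. X), ar = (\<lambda>f. f)\<rparr>"

definition comp_funct ::
    "('p, 'b, 'q, 'c) funct \<Rightarrow> ('o, 'a, 'p, 'b) funct \<Rightarrow> ('o, 'a, 'q, 'c) funct"
    (infixr "\<circ>\<^sub>F" 75) where
  "G \<circ>\<^sub>F F = \<lparr>ob = (\<lambda>X. ob G (ob F X)), ar = (\<lambda>f. ar G (ar F f))\<rparr>"

definition nat_trans :: "('o, 'a) cat \<Rightarrow> ('p, 'b) cat \<Rightarrow>
    ('o, 'a, 'p, 'b) funct \<Rightarrow> ('o, 'a, 'p, 'b) funct \<Rightarrow> ('o \<Rightarrow> 'b) \<Rightarrow> bool" where
  "nat_trans A B F G \<alpha> \<longleftrightarrow> is_functor A B F \<and> is_functor A B G \<and>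
     (\<forall>X \<in> Obj A. \<alpha> X \<in> Hom B (ob F X) (ob G X)) \<and>
     (\<forall>f \<in> Arr A. \<alpha> (Cod A f) \<cdot>\<^bsub>B\<^esub> ar F f = ar G f \<cdot>\<^bsub>B\<^esub> \<alpha> (Dom A f))"

definition invertible_trans :: "('o, 'a) cat \<Rightarrow> ('p, 'b) cat \<Rightarrow>
    ('o, 'a, 'p, 'b) funct \<Rightarrow> ('o, 'a, 'p, 'b) funct \<Rightarrow> ('o \<Rightarrow> 'b) \<Rightarrow> bool" where
  "invertible_trans A B F G \<alpha> \<longleftrightarrow> nat_trans A B F G \<alpha> \<and>
     (\<exists>\<beta>. nat_trans A B G F \<beta> \<and>
        (\<forall>X \<in> Obj A. \<beta> X \<cdot>\<^bsub>B\<^esub> \<alpha> X = Ide B (ob F X) \<and> \<alpha> X \<cdot>\<^bsub>B\<^esub> \<beta> X = Ide B (ob G X)))"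

definition conservative ::
    "('o, 'a) cat \<Rightarrow> ('p, 'b) cat \<Rightarrow> ('o, 'a, 'p, 'b) funct \<Rightarrow> bool" where
  "conservative A B F \<longleftrightarrow> (\<forall>f \<in> Arr A. is_iso B (ar F f) \<longrightarrow> is_iso A f)"

definition adjunction :: "('o, 'a) cat \<Rightarrow> ('p, 'b) cat \<Rightarrow>
    ('o, 'a, 'p, 'b) funct \<Rightarrow> ('p, 'b, 'o, 'a) funct \<Rightarrow> ('o \<Rightarrow> 'a) \<Rightarrow> ('p \<Rightarrow> 'b) \<Rightarrow> bool" where
  "adjunction A B F G \<eta> \<xi> \<longleftrightarrow>
     is_functor A B F \<and> is_functor B A G \<and>
     nat_trans A A id_funct (G \<circ>\<^sub>F F) \<eta> \<and>
     nat_trans B B (F \<circ>\<^sub>F G) id_funct \<xi> \<and>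
     (\<forall>X \<in> Obj A. \<xi> (ob F X) \<cdot>\<^bsub>B\<^esub> ar F (\<eta> X) = Ide B (ob F X)) \<and>
     (\<forall>Y \<in> Obj B. ar G (\<xi> Y) \<cdot>\<^bsub>A\<^esub> \<eta> (ob G Y) = Ide A (ob G Y))"

definition adjoint_equivalence :: "('o, 'a) cat \<Rightarrow> ('p, 'b) cat \<Rightarrow>
    ('o, 'a, 'p, 'b) funct \<Rightarrow> ('p, 'b, 'o, 'a) funct \<Rightarrow> ('o \<Rightarrow> 'a) \<Rightarrow> ('p \<Rightarrow> 'b) \<Rightarrow> bool" where
  "adjoint_equivalence A B F G \<eta> \<xi> \<longleftrightarrow>
     adjunction A B F G \<eta> \<xi> \<and>
     invertible_trans A A id_funct (G \<circ>\<^sub>F F) \<eta> \<and>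
     invertible_trans B B (F \<circ>\<^sub>F G) id_funct \<xi>"

definition coreflexive_pair :: "('o, 'a) cat \<Rightarrow> 'a \<Rightarrow> 'a \<Rightarrow> bool" where
  "coreflexive_pair A f g \<longleftrightarrow>
     f \<in> Arr A \<and> g \<in> Arr A \<and> Dom A f = Dom A g \<and> Cod A f = Cod A g \<and>
     (\<exists>r \<in> Hom A (Cod A f) (Dom A f).
        r \<cdot>\<^bsub>A\<^esub> f = Ide A (Dom A f) \<and> r \<cdot>\<^bsub>A\<^esub> g = Ide A (Dom A f))"

definition is_equalizer :: "('o, 'a) cat \<Rightarrow> 'a \<Rightarrow> 'a \<Rightarrow> 'a \<Rightarrow> bool" where
  "is_equalizer A f g e \<longleftrightarrow>
     f \<in> Arr A \<and> g \<in> Arr A \<and> Dom A f = Dom A g \<and> Cod A f = Cod A g \<and>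
     e \<in> Arr A \<and> Cod A e = Dom A f \<and> f \<cdot>\<^bsub>A\<^esub> e = g \<cdot>\<^bsub>A\<^esub> e \<and>
     (\<forall>h \<in> Arr A. Cod A h = Dom A f \<and> f \<cdot>\<^bsub>A\<^esub> h = g \<cdot>\<^bsub>A\<^esub> h \<longrightarrow>
        (\<exists>!k. k \<in> Hom A (Dom A h) (Dom A e) \<and> e \<cdot>\<^bsub>A\<^esub> k = h))"

definition has_coreflexive_equalizers :: "('o, 'a) cat \<Rightarrow> bool" where
  "has_coreflexive_equalizers A \<longleftrightarrow>
     (\<forall>f g. coreflexive_pair A f g \<longrightarrow> (\<exists>e. is_equalizer A f g e))"

definition preserves_coreflexive_equalizers ::
    "('o, 'a) cat \<Rightarrow> ('p, 'b) cat \<Rightarrow> ('o, 'a, 'p, 'b) funct \<Rightarrow> bool" where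
  "preserves_coreflexive_equalizers A B F \<longleftrightarrow>
     (\<forall>f g e. coreflexive_pair A f g \<and> is_equalizer A f g e \<longrightarrow>
        is_equalizer B (ar F f) (ar F g) (ar F e))"

record ('o, 'a) comonad_data =
  Fun :: "('o, 'a, 'o, 'a) funct"
  comult :: "'o \<Rightarrow> 'a"
  counit :: "'o \<Rightarrow> 'a"

definition comonad :: "('o, 'a) cat \<Rightarrow> ('o, 'a) comonad_data \<Rightarrow> bool" where
  "comonad A T \<longleftrightarrow>
     is_functor A A (Fun T) \<and>
     nat_trans A A (Fun T) (Fun T \<circ>\<^sub>F Fun T) (comult T) \<and>
     nat_trans A A (Fun T) id_funct (counit T) \<and>
     (\<forall>X \<in> Obj A.
        comult T (ob (Fun T) X) \<cdot>\<^bsub>A\<^esub> comult T X = ar (Fun T) (comult T X) \<cdot>\<^bsub>A\<^esub> comult T X \<and>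
        counit T (ob (Fun T) X) \<cdot>\<^bsub>A\<^esub> comult T X = Ide A (ob (Fun T) X) \<and>
        ar (Fun T) (counit T X) \<cdot>\<^bsub>A\<^esub> comult T X = Ide A (ob (Fun T) X))"

definition colax_morphism :: "('o, 'a) cat \<Rightarrow> ('o, 'a) comonad_data \<Rightarrow>
    ('p, 'b) cat \<Rightarrow> ('p, 'b) comonad_data \<Rightarrow>
    ('o, 'a, 'p, 'b) funct \<Rightarrow> ('o \<Rightarrow> 'b) \<Rightarrow> bool" where
  "colax_morphism M C N D H \<sigma> \<longleftrightarrow>
     nat_trans M N (H \<circ>\<^sub>F Fun C) (Fun D \<circ>\<^sub>F H) \<sigma> \<and>
     (\<forall>X \<in> Obj M.
        comult D (ob H X) \<cdot>\<^bsub>N\<^esub> \<sigma> X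
          = ar (Fun D) (\<sigma> X) \<cdot>\<^bsub>N\<^esub> \<sigma> (ob (Fun C) X) \<cdot>\<^bsub>N\<^esub> ar H (comult C X) \<and>
        counit D (ob H X) \<cdot>\<^bsub>N\<^esub> \<sigma> X = ar H (counit C X))"

type_synonym ('o, 'a) coalg = "'o \<times> 'a"

text \<open>The same arrow of \<open>A\<close> may be a morphism between several pairs of coalgebras, so a
  morphism of coalgebras is a triple recording its domain and codomain.\<close>

type_synonym ('o, 'a) coalg_mor = "('o, 'a) coalg \<times> 'a \<times> ('o, 'a) coalg"

definition is_coalg :: "('o, 'a) cat \<Rightarrow> ('o, 'a) comonad_data \<Rightarrow> ('o, 'a) coalg \<Rightarrow> bool" where
  "is_coalg A T = (\<lambda>(X, c).
     X \<in> Obj A \<and> c \<in> Hom A X (ob (Fun T) X) \<and>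
     comult T X \<cdot>\<^bsub>A\<^esub> c = ar (Fun T) c \<cdot>\<^bsub>A\<^esub> c \<and>
     counit T X \<cdot>\<^bsub>A\<^esub> c = Ide A X)"

definition is_coalg_mor ::
    "('o, 'a) cat \<Rightarrow> ('o, 'a) comonad_data \<Rightarrow> ('o, 'a) coalg_mor \<Rightarrow> bool" where
  "is_coalg_mor A T = (\<lambda>((X, c), f, (Y, d)).
     is_coalg A T (X, c) \<and> is_coalg A T (Y, d) \<and> f \<in> Hom A X Y \<and>
     d \<cdot>\<^bsub>A\<^esub> f = ar (Fun T) f \<cdot>\<^bsub>A\<^esub> c)"

definition coalg_cat :: "('o, 'a) cat \<Rightarrow> ('o, 'a) comonad_data \<Rightarrow>
    (('o, 'a) coalg, ('o, 'a) coalg_mor) cat" where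
  "coalg_cat A T =
     \<lparr>Obj = {p. is_coalg A T p},
      Arr = {\<phi>. is_coalg_mor A T \<phi>},
      Dom = (\<lambda>(p, f, q). p),
      Cod = (\<lambda>(p, f, q). q),
      Ide = (\<lambda>p. (p, Ide A (fst p), p)),
      Comp = (\<lambda>(q, g, r) (p, f, q'). (p, g \<cdot>\<^bsub>A\<^esub> f, r))\<rparr>"

definition cofree :: "('o, 'a) comonad_data \<Rightarrow> 'o \<Rightarrow> ('o, 'a) coalg" where
  "cofree T X = (ob (Fun T) X, comult T X)"

definition mate :: "('o, 'a) cat \<Rightarrow> ('o, 'a) comonad_data \<Rightarrow> ('p, 'b) comonad_data \<Rightarrow>
    ('p, 'b, 'o, 'a) funct \<Rightarrow> ('o \<Rightarrow> 'a) \<Rightarrow> ('p \<Rightarrow> 'b) \<Rightarrow> ('o \<Rightarrow> 'b) \<Rightarrow> 'p \<Rightarrow> 'a" where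
  "mate M C D K \<eta> \<xi> \<sigma> = (\<lambda>Y.
     ar K (ar (Fun D) (\<xi> Y)) \<cdot>\<^bsub>M\<^esub> ar K (\<sigma> (ob K Y)) \<cdot>\<^bsub>M\<^esub> \<eta> (ob (Fun C) (ob K Y)))"

definition conj_comonad :: "('p, 'b) cat \<Rightarrow> ('o, 'a) comonad_data \<Rightarrow>
    ('o, 'a, 'p, 'b) funct \<Rightarrow> ('p, 'b, 'o, 'a) funct \<Rightarrow> ('o \<Rightarrow> 'a) \<Rightarrow> ('p \<Rightarrow> 'b) \<Rightarrow>
    ('p, 'b) comonad_data" where
  "conj_comonad N C H K \<eta> \<xi> =
     \<lparr>Fun = H \<circ>\<^sub>F Fun C \<circ>\<^sub>F K,
      comult = (\<lambda>Y. ar H (ar (Fun C) (\<eta> (ob (Fun C) (ob K Y)))) \<cdot>\<^bsub>N\<^esub> ar H (comult C (ob K Y))),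
      counit = (\<lambda>Y. \<xi> Y \<cdot>\<^bsub>N\<^esub> ar H (counit C (ob K Y)))\<rparr>"

text \<open>The transformation \<open>\<sigma>'\<close>; its universal property is lemmas
  \<open>conj_trans_nat\<close>, \<open>conj_trans_factor\<close> and \<open>conj_trans_unique\<close> below.\<close>

definition conj_trans :: "('p, 'b) cat \<Rightarrow> ('p, 'b) comonad_data \<Rightarrow>
    ('p, 'b, 'o, 'a) funct \<Rightarrow> ('p \<Rightarrow> 'b) \<Rightarrow> ('o \<Rightarrow> 'b) \<Rightarrow> 'p \<Rightarrow> 'b" where
  "conj_trans N D K \<xi> \<sigma> = (\<lambda>Y. ar (Fun D) (\<xi> Y) \<cdot>\<^bsub>N\<^esub> \<sigma> (ob K Y))"

definition H_ob :: "('p, 'b) cat \<Rightarrow> ('o, 'a, 'p, 'b) funct \<Rightarrow> ('o \<Rightarrow> 'b) \<Rightarrow>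
    ('o, 'a) coalg \<Rightarrow> ('p, 'b) coalg" where
  "H_ob N H \<sigma> = (\<lambda>(X, c). (ob H X, \<sigma> X \<cdot>\<^bsub>N\<^esub> ar H c))"

definition H_funct :: "('p, 'b) cat \<Rightarrow> ('o, 'a, 'p, 'b) funct \<Rightarrow> ('o \<Rightarrow> 'b) \<Rightarrow>
    (('o, 'a) coalg, ('o, 'a) coalg_mor, ('p, 'b) coalg, ('p, 'b) coalg_mor) funct" where
  "H_funct N H \<sigma> =
     \<lparr>ob = H_ob N H \<sigma>, ar = (\<lambda>(p, f, q). (H_ob N H \<sigma> p, ar H f, H_ob N H \<sigma> q))\<rparr>"

definition K_left :: "('o, 'a) cat \<Rightarrow> ('o, 'a) comonad_data \<Rightarrow> ('p, 'b) comonad_data \<Rightarrow>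
    ('p, 'b, 'o, 'a) funct \<Rightarrow> ('p \<Rightarrow> 'a) \<Rightarrow> ('p, 'b) coalg \<Rightarrow> ('o, 'a) coalg_mor" where
  "K_left M C D K \<tau> = (\<lambda>(Y, d).
     (cofree C (ob K Y),
      ar (Fun C) (\<tau> Y) \<cdot>\<^bsub>M\<^esub> comult C (ob K Y),
      cofree C (ob K (ob (Fun D) Y))))"

definition K_right :: "('o, 'a) comonad_data \<Rightarrow> ('p, 'b) comonad_data \<Rightarrow>
    ('p, 'b, 'o, 'a) funct \<Rightarrow> ('p, 'b) coalg \<Rightarrow> ('o, 'a) coalg_mor" where
  "K_right C D K = (\<lambda>(Y, d).
     (cofree C (ob K Y), ar (Fun C) (ar K d), cofree C (ob K (ob (Fun D) Y))))"

text \<open>The canonical map from \<open>K\<^sup>\<tau>(Y, d)\<close> to the cofree coalgebra on \<open>K Y\<close>. Equalizers are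
  determined only up to isomorphism, so one is chosen for every coalgebra.\<close>

definition K_can :: "('o, 'a) cat \<Rightarrow> ('o, 'a) comonad_data \<Rightarrow> ('p, 'b) comonad_data \<Rightarrow>
    ('p, 'b, 'o, 'a) funct \<Rightarrow> ('p \<Rightarrow> 'a) \<Rightarrow> ('p, 'b) coalg \<Rightarrow> ('o, 'a) coalg_mor" where
  "K_can M C D K \<tau> q =
     (SOME e. is_equalizer (coalg_cat M C) (K_left M C D K \<tau> q) (K_right C D K q) e)"

definition K_ob :: "('o, 'a) cat \<Rightarrow> ('o, 'a) comonad_data \<Rightarrow> ('p, 'b) comonad_data \<Rightarrow>
    ('p, 'b, 'o, 'a) funct \<Rightarrow> ('p \<Rightarrow> 'a) \<Rightarrow> ('p, 'b) coalg \<Rightarrow> ('o, 'a) coalg" where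
  "K_ob M C D K \<tau> q = Dom (coalg_cat M C) (K_can M C D K \<tau> q)"

text \<open>On a morphism \<open>f : p \<rightarrow> q\<close> the functor \<open>K\<^sup>\<tau>\<close> is the map induced by \<open>C K f\<close> between the
  equalizers.\<close>

definition K_funct :: "('o, 'a) cat \<Rightarrow> ('o, 'a) comonad_data \<Rightarrow> ('p, 'b) comonad_data \<Rightarrow>
    ('p, 'b, 'o, 'a) funct \<Rightarrow> ('p \<Rightarrow> 'a) \<Rightarrow>
    (('p, 'b) coalg, ('p, 'b) coalg_mor, ('o, 'a) coalg, ('o, 'a) coalg_mor) funct" where
  "K_funct M C D K \<tau> =
     \<lparr>ob = K_ob M C D K \<tau>,
      ar = (\<lambda>(p, f, q).
        THE k. k \<in> Hom (coalg_cat M C) (K_ob M C D K \<tau> p) (K_ob M C D K \<tau> q) \<and>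
          K_can M C D K \<tau> q \<cdot>\<^bsub>coalg_cat M C\<^esub> k
            = (cofree C (ob K (fst p)), ar (Fun C) (ar K f), cofree C (ob K (fst q)))
                \<cdot>\<^bsub>coalg_cat M C\<^esub> K_can M C D K \<tau> p)\<rparr>"

definition HK_unit :: "('o, 'a) cat \<Rightarrow> ('o, 'a) comonad_data \<Rightarrow>
    ('p, 'b) cat \<Rightarrow> ('p, 'b) comonad_data \<Rightarrow>
    ('o, 'a, 'p, 'b) funct \<Rightarrow> ('p, 'b, 'o, 'a) funct \<Rightarrow> ('o \<Rightarrow> 'a) \<Rightarrow>
    ('o \<Rightarrow> 'b) \<Rightarrow> ('p \<Rightarrow> 'a) \<Rightarrow> ('o, 'a) coalg \<Rightarrow> ('o, 'a) coalg_mor" where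
  "HK_unit M C N D H K \<eta> \<sigma> \<tau> = (\<lambda>(X, c).
     THE k. k \<in> Hom (coalg_cat M C) (X, c) (K_ob M C D K \<tau> (H_ob N H \<sigma> (X, c))) \<and>
       K_can M C D K \<tau> (H_ob N H \<sigma> (X, c)) \<cdot>\<^bsub>coalg_cat M C\<^esub> k
         = ((X, c), ar (Fun C) (\<eta> X) \<cdot>\<^bsub>M\<^esub> c, cofree C (ob K (ob H X))))"

definition HK_counit :: "('o, 'a) cat \<Rightarrow> ('o, 'a) comonad_data \<Rightarrow>
    ('p, 'b) cat \<Rightarrow> ('p, 'b) comonad_data \<Rightarrow>
    ('o, 'a, 'p, 'b) funct \<Rightarrow> ('p, 'b, 'o, 'a) funct \<Rightarrow> ('p \<Rightarrow> 'b) \<Rightarrow>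
    ('o \<Rightarrow> 'b) \<Rightarrow> ('p \<Rightarrow> 'a) \<Rightarrow> ('p, 'b) coalg \<Rightarrow> ('p, 'b) coalg_mor" where
  "HK_counit M C N D H K \<xi> \<sigma> \<tau> = (\<lambda>(Y, d).
     case K_can M C D K \<tau> (Y, d) of (p, e, q) \<Rightarrow>
       (H_ob N H \<sigma> p,
        \<xi> Y \<cdot>\<^bsub>N\<^esub> ar H (counit C (ob K Y)) \<cdot>\<^bsub>N\<^esub> ar H e,
        (Y, d)))"

lemma HomI: "f \<in> Arr A \<Longrightarrow> Dom A f = X \<Longrightarrow> Cod A f = Y \<Longrightarrow> f \<in> Hom A X Y"
  by (simp add: Hom_def)

lemma HomD: "f \<in> Hom A X Y \<Longrightarrow> f \<in> Arr A \<and> Dom A f = X \<and> Cod A f = Y"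
  by (simp add: Hom_def)

lemma ar_in_Hom: "is_functor A B F \<Longrightarrow> f \<in> Hom A X Y \<Longrightarrow> ar F f \<in> Hom B (ob F X) (ob F Y)"
  by (auto simp: is_functor_def Hom_def)

lemma ar_Comp: "is_functor A B F \<Longrightarrow> f \<in> Hom A X Y \<Longrightarrow> g \<in> Hom A Y Z \<Longrightarrow>
    ar F (g \<cdot>\<^bsub>A\<^esub> f) = ar F g \<cdot>\<^bsub>B\<^esub> ar F f"
  by (auto simp: is_functor_def Hom_def)

lemma nat_trans_in_Hom:
  "nat_trans A B F G \<alpha> \<Longrightarrow> X \<in> Obj A \<Longrightarrow> \<alpha> X \<in> Hom B (ob F X) (ob G X)"
  by (simp add: nat_trans_def)

lemma nat_trans_natural:
  "nat_trans A B F G \<alpha> \<Longrightarrow> f \<in> Hom A X Y \<Longrightarrow> \<alpha> Y \<cdot>\<^bsub>B\<^esub> ar F f = ar G f \<cdot>\<^bsub>B\<^esub> \<alpha> X"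
  by (auto simp: nat_trans_def Hom_def)

lemma is_functor_comp:
  assumes F: "is_functor A B F" and G: "is_functor B C G"
  shows "is_functor A C (G \<circ>\<^sub>F F)"
  unfolding is_functor_def
proof (intro conjI ballI impI)
  fix f g assume fg: "f \<in> Arr A" "g \<in> Arr A" "Cod A f = Dom A g"
  have f: "f \<in> Hom A (Dom A f) (Dom A g)" and g: "g \<in> Hom A (Dom A g) (Cod A g)"
    using fg by (auto simp: Hom_def)
  show "ar (G \<circ>\<^sub>F F) (g \<cdot>\<^bsub>A\<^esub> f) = ar (G \<circ>\<^sub>F F) g \<cdot>\<^bsub>C\<^esub> ar (G \<circ>\<^sub>F F) f"
    by (simp add: comp_funct_def ar_Comp[OF F f g]
        ar_Comp[OF G ar_in_Hom[OF F f] ar_in_Hom[OF F g]])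
next
  fix f assume "f \<in> Arr A"
  then have f: "f \<in> Hom A (Dom A f) (Cod A f)" by (simp add: Hom_def)
  show "ar (G \<circ>\<^sub>F F) f \<in> Hom C (ob (G \<circ>\<^sub>F F) (Dom A f)) (ob (G \<circ>\<^sub>F F) (Cod A f))"
    using ar_in_Hom[OF G ar_in_Hom[OF F f]] by (simp add: comp_funct_def)
qed (use F G in \<open>auto simp: is_functor_def comp_funct_def\<close>)

context
  fixes M :: "('o, 'a) cat" and N :: "('p, 'b) cat"
    and C :: "('o, 'a) comonad_data" and D :: "('p, 'b) comonad_data"
    and H :: "('o, 'a, 'p, 'b) funct" and K :: "('p, 'b, 'o, 'a) funct"
    and \<eta> :: "'o \<Rightarrow> 'a" and \<xi> :: "'p \<Rightarrow> 'b" and \<sigma> :: "'o \<Rightarrow> 'b"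
  assumes adj: "adjunction M N H K \<eta> \<xi>"
    and C: "comonad M C" and D: "comonad N D"
    and \<sigma>: "nat_trans M N (H \<circ>\<^sub>F Fun C) (Fun D \<circ>\<^sub>F H) \<sigma>"
begin

private lemma functs: "is_functor M N H" "is_functor N M K" "is_functor M M (Fun C)"
    "is_functor N N (Fun D)" "category M" "category N"
  using adj C D unfolding adjunction_def comonad_def is_functor_def[of M N] by auto

private lemma obs: "X \<in> Obj M \<Longrightarrow> ob H X \<in> Obj N" "Y \<in> Obj N \<Longrightarrow> ob K Y \<in> Obj M"
    "X \<in> Obj M \<Longrightarrow> ob (Fun C) X \<in> Obj M" "Y \<in> Obj N \<Longrightarrow> ob (Fun D) Y \<in> Obj N"
  using functs unfolding is_functor_def by auto

private lemma eta_in: "X \<in> Obj M \<Longrightarrow> \<eta> X \<in> Hom M X (ob K (ob H X))"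
  using adj unfolding adjunction_def nat_trans_def by (auto simp: id_funct_def comp_funct_def)

private lemma xi_in: "Y \<in> Obj N \<Longrightarrow> \<xi> Y \<in> Hom N (ob H (ob K Y)) Y"
  using adj unfolding adjunction_def nat_trans_def by (auto simp: id_funct_def comp_funct_def)

private lemma xi_nat: "f \<in> Hom N X Y \<Longrightarrow> \<xi> Y \<cdot>\<^bsub>N\<^esub> ar H (ar K f) = f \<cdot>\<^bsub>N\<^esub> \<xi> X"
  using adj unfolding adjunction_def
  by (auto dest: nat_trans_natural simp: id_funct_def comp_funct_def)

private lemma sigma_in:
  "X \<in> Obj M \<Longrightarrow> \<sigma> X \<in> Hom N (ob H (ob (Fun C) X)) (ob (Fun D) (ob H X))"
  using nat_trans_in_Hom[OF \<sigma>] by (simp add: comp_funct_def)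

private lemma sigma_nat: "f \<in> Hom M X Y \<Longrightarrow>
    \<sigma> Y \<cdot>\<^bsub>N\<^esub> ar H (ar (Fun C) f) = ar (Fun D) (ar H f) \<cdot>\<^bsub>N\<^esub> \<sigma> X"
  using nat_trans_natural[OF \<sigma>] by (auto simp: comp_funct_def)

lemma conj_trans_nat:
  "nat_trans N N (Fun (conj_comonad N C H K \<eta> \<xi>)) (Fun D) (conj_trans N D K \<xi> \<sigma>)"
  unfolding nat_trans_def
proof (intro conjI ballI)
  interpret N: category N by (rule functs)
  show "is_functor N N (Fun (conj_comonad N C H K \<eta> \<xi>))"
    using functs by (auto simp: conj_comonad_def intro!: is_functor_comp)
  show "is_functor N N (Fun D)" by (rule functs)
  fix Y assume Y: "Y \<in> Obj N"
  show "conj_trans N D K \<xi> \<sigma> Y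
      \<in> Hom N (ob (Fun (conj_comonad N C H K \<eta> \<xi>)) Y) (ob (Fun D) Y)"
    using N.Comp_in[OF sigma_in[OF obs(2)[OF Y]] ar_in_Hom[OF functs(4) xi_in[OF Y]]]
    by (simp add: conj_trans_def conj_comonad_def comp_funct_def)
next
  interpret N: category N by (rule functs)
  fix f assume "f \<in> Arr N"
  then obtain X Y where f: "f \<in> Hom N X Y" and XY: "X = Dom N f" "Y = Cod N f"
    by (auto simp: Hom_def)
  have X: "X \<in> Obj N" and Y: "Y \<in> Obj N"
    using XY \<open>f \<in> Arr N\<close> N.Dom_in N.Cod_in by auto
  let ?D = "ar (Fun D)"
  note Kf = ar_in_Hom[OF functs(2) f]
  note HCKf = ar_in_Hom[OF functs(1) ar_in_Hom[OF functs(3) Kf]]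
  note HKf = ar_in_Hom[OF functs(1) Kf]
  note sX = sigma_in[OF obs(2)[OF X]] and sY = sigma_in[OF obs(2)[OF Y]]
  note xX = xi_in[OF X] and xY = xi_in[OF Y]
  note DX = ar_in_Hom[OF functs(4) xX] and DY = ar_in_Hom[OF functs(4) xY]
  have "(?D (\<xi> Y) \<cdot>\<^bsub>N\<^esub> \<sigma> (ob K Y)) \<cdot>\<^bsub>N\<^esub> ar H (ar (Fun C) (ar K f))
      = ?D (\<xi> Y) \<cdot>\<^bsub>N\<^esub> (?D (ar H (ar K f)) \<cdot>\<^bsub>N\<^esub> \<sigma> (ob K X))"
    by (simp add: N.Comp_assoc[OF HCKf sY DY] sigma_nat[OF Kf])
  also have "\<dots> = ?D (\<xi> Y \<cdot>\<^bsub>N\<^esub> ar H (ar K f)) \<cdot>\<^bsub>N\<^esub> \<sigma> (ob K X)"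
    by (simp add: ar_Comp[OF functs(4) HKf xY]
        N.Comp_assoc[OF sX ar_in_Hom[OF functs(4) HKf] DY])
  also have "\<dots> = ?D f \<cdot>\<^bsub>N\<^esub> (?D (\<xi> X) \<cdot>\<^bsub>N\<^esub> \<sigma> (ob K X))"
    by (simp add: xi_nat[OF f] ar_Comp[OF functs(4) xX f]
        N.Comp_assoc[OF sX DX ar_in_Hom[OF functs(4) f]])
  finally show "conj_trans N D K \<xi> \<sigma> (Cod N f) \<cdot>\<^bsub>N\<^esub> ar (Fun (conj_comonad N C H K \<eta> \<xi>)) f
      = ar (Fun D) f \<cdot>\<^bsub>N\<^esub> conj_trans N D K \<xi> \<sigma> (Dom N f)"
    by (simp add: conj_trans_def conj_comonad_def comp_funct_def XY)
qed

lemma conj_trans_factor: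
  assumes X: "X \<in> Obj M"
  shows "conj_trans N D K \<xi> \<sigma> (ob H X) \<cdot>\<^bsub>N\<^esub> ar H (ar (Fun C) (\<eta> X)) = \<sigma> X"
proof -
  interpret N: category N by (rule functs)
  let ?D = "ar (Fun D)"
  note e = eta_in[OF X]
  note HX = obs(1)[OF X]
  note x = xi_in[OF HX]
  note He = ar_in_Hom[OF functs(1) e]
  note sX = sigma_in[OF X] and sKH = sigma_in[OF obs(2)[OF HX]]
  have tri: "\<xi> (ob H X) \<cdot>\<^bsub>N\<^esub> ar H (\<eta> X) = Ide N (ob H X)"
    using adj X by (simp add: adjunction_def)
  have "conj_trans N D K \<xi> \<sigma> (ob H X) \<cdot>\<^bsub>N\<^esub> ar H (ar (Fun C) (\<eta> X))
      = ?D (\<xi> (ob H X)) \<cdot>\<^bsub>N\<^esub> (?D (ar H (\<eta> X)) \<cdot>\<^bsub>N\<^esub> \<sigma> X)"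
    by (simp add: conj_trans_def sigma_nat[OF e] N.Comp_assoc[OF
          ar_in_Hom[OF functs(1) ar_in_Hom[OF functs(3) e]] sKH ar_in_Hom[OF functs(4) x]])
  also have "\<dots> = ?D (Ide N (ob H X)) \<cdot>\<^bsub>N\<^esub> \<sigma> X"
    by (simp flip: tri add: ar_Comp[OF functs(4) He x]
        N.Comp_assoc[OF sX ar_in_Hom[OF functs(4) He] ar_in_Hom[OF functs(4) x]])
  also have "\<dots> = \<sigma> X"
    using functs(4) HX N.Ide_Comp[OF sX] by (simp add: is_functor_def)
  finally show ?thesis .
qed

lemma conj_trans_unique:
  assumes s: "nat_trans N N (Fun (conj_comonad N C H K \<eta> \<xi>)) (Fun D) s"
    and eq: "\<And>X. X \<in> Obj M \<Longrightarrow> s (ob H X) \<cdot>\<^bsub>N\<^esub> ar H (ar (Fun C) (\<eta> X)) = \<sigma> X"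
    and Y: "Y \<in> Obj N"
  shows "s Y = conj_trans N D K \<xi> \<sigma> Y"
proof -
  interpret N: category N by (rule functs)
  note KY = obs(2)[OF Y]
  note HKY = obs(1)[OF KY]
  note x = xi_in[OF Y] and e = eta_in[OF KY]
  note Kx = ar_in_Hom[OF functs(2) x]
  note HC = ar_in_Hom[OF functs(1) ar_in_Hom[OF functs(3)]]
  have s_in: "s Y \<in> Hom N (ob H (ob (Fun C) (ob K Y))) (ob (Fun D) Y)" if "Y \<in> Obj N" for Y
    using nat_trans_in_Hom[OF s that] by (simp add: conj_comonad_def comp_funct_def)
  have s_nat: "s Y \<cdot>\<^bsub>N\<^esub> ar H (ar (Fun C) (ar K f)) = ar (Fun D) f \<cdot>\<^bsub>N\<^esub> s X"
    if "f \<in> Hom N X Y" for f X Y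
    using nat_trans_natural[OF s that] by (simp add: conj_comonad_def comp_funct_def)
  have tri: "ar K (\<xi> Y) \<cdot>\<^bsub>M\<^esub> \<eta> (ob K Y) = Ide M (ob K Y)"
    using adj Y by (simp add: adjunction_def)
  have "ar H (ar (Fun C) (ar K (\<xi> Y))) \<cdot>\<^bsub>N\<^esub> ar H (ar (Fun C) (\<eta> (ob K Y)))
      = ar H (ar (Fun C) (Ide M (ob K Y)))"
    by (simp flip: tri add: ar_Comp[OF functs(3) e Kx]
        ar_Comp[OF functs(1) ar_in_Hom[OF functs(3) e] ar_in_Hom[OF functs(3) Kx]])
  also have "\<dots> = Ide N (ob H (ob (Fun C) (ob K Y)))"
    using functs KY obs by (simp add: is_functor_def)
  finally have "s Y = s Y \<cdot>\<^bsub>N\<^esub> (ar H (ar (Fun C) (ar K (\<xi> Y))) \<cdot>\<^bsub>N\<^esub> ar H (ar (Fun C) (\<eta> (ob K Y))))"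
    using N.Comp_Ide[OF s_in[OF Y]] by simp
  also have "\<dots> = (ar (Fun D) (\<xi> Y) \<cdot>\<^bsub>N\<^esub> s (ob H (ob K Y))) \<cdot>\<^bsub>N\<^esub> ar H (ar (Fun C) (\<eta> (ob K Y)))"
    by (simp add: N.Comp_assoc[OF HC[OF e] HC[OF Kx] s_in[OF Y]] flip: s_nat[OF x])
  also have "\<dots> = ar (Fun D) (\<xi> Y) \<cdot>\<^bsub>N\<^esub> \<sigma> (ob K Y)"
    using N.Comp_assoc[OF HC[OF e] s_in[OF HKY] ar_in_Hom[OF functs(4) x]] eq[OF KY] by simp
  finally show ?thesis by (simp add: conj_trans_def)
qed

end

end

theory Submission
  imports Defs
begin

text \<open>
  The functor \<open>H\<close> lifts to coalgebras, and its right adjoint lifts as soon as the pair that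
  defines \<open>K\<^sup>\<tau>\<close> has an equalizer of coalgebras. That pair is coreflexive, with retraction
  \<open>C (K \<epsilon>)\<close> (\<open>left_retraction\<close>), and \<open>C\<close> and \<open>C C\<close> preserve its equalizer in \<open>M\<close>; hence the
  equalizer lifts to coalgebras (\<open>coalg_equalizer_of_preserved\<close>), and the canonical
  map \<open>e : K\<^sup>\<tau>(Y, d) \<rightarrow> C K Y\<close> is an equalizer in \<open>M\<close> as well. The adjunction
  (\<open>lifted_adjunction\<close>) is then read off from the universal property of the counit: a coalgebra
  morphism from \<open>(X, c)\<close> into \<open>K\<^sup>\<tau>(Y, d)\<close> is determined by a morphism into the cofree coalgebra
  on \<open>K Y\<close>, this by a map \<open>X \<rightarrow> K Y\<close>, and this by its transpose \<open>H X \<rightarrow> Y\<close>, which is its composite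
  with the counit (\<open>cnt_inj\<close>).

  Everything else is controlled by one formula. The underlying map of the counit is
  \<open>v = \<xi> H(\<epsilon>) H(e) = \<epsilon> \<sigma>' H(e)\<close>, and it satisfies \<open>d v = \<sigma>' H(e)\<close> (\<open>coaction_cnt\<close>). Suppose that
  \<open>\<sigma>'\<close> is invertible. It identifies the image under \<open>H\<close> of the pair defining \<open>K\<^sup>\<tau>(Y, d)\<close>, whose
  equalizer is \<open>H(e)\<close>, with the pair \<open>\<delta>, D d\<close>, whose equalizer is \<open>d\<close>. The formula says that
  \<open>v\<close> is the comparison of these equalizers, so it is invertible (\<open>cnt_iso\<close>). By a triangle
  identity \<open>H\<close> of the unit is then invertible too, and \<open>H\<close> is conservative.

  Conversely, at the cofree coalgebra on \<open>Y\<close> the defining pair is split and its equalizer is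
  \<open>C K Y\<close>: right adjoints compose, and \<open>H\<^sub>\<sigma>\<close> lies over \<open>H\<close>. Under this identification the counit
  becomes \<open>\<sigma>'\<close> at \<open>Y\<close> (\<open>cofree_can_iso\<close>), so an invertible counit makes \<open>\<sigma>'\<close> invertible.
\<close>

section \<open>Categories, functors and equalizers\<close>

context category
begin

lemmas [simp] = Dom_in Cod_in

lemma Comp_Arr [simp]:
  assumes "f \<in> Arr A" "g \<in> Arr A" "Dom A g = Cod A f"
  shows "g \<cdot> f \<in> Arr A" "Dom A (g \<cdot> f) = Dom A f" "Cod A (g \<cdot> f) = Cod A g"
  using Comp_in[of f "Dom A f" "Cod A f" g "Cod A g"] assms by (auto simp: Hom_def)

lemma Ide_Arr [simp]:
  assumes "X \<in> Obj A"
  shows "Ide A X \<in> Arr A" "Dom A (Ide A X) = X" "Cod A (Ide A X) = X"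
  using Ide_in[OF assms] by (auto simp: Hom_def)

lemma Ide_neutral [simp]:
  "f \<in> Arr A \<Longrightarrow> Dom A f = X \<Longrightarrow> f \<cdot> Ide A X = f"
  "f \<in> Arr A \<Longrightarrow> Cod A f = X \<Longrightarrow> Ide A X \<cdot> f = f"
  using Comp_Ide Ide_Comp by (auto simp: Hom_def)

lemma assoc [simp]:
  "f \<in> Arr A \<Longrightarrow> g \<in> Arr A \<Longrightarrow> h \<in> Arr A \<Longrightarrow> Dom A g = Cod A f \<Longrightarrow> Dom A h = Cod A g \<Longrightarrow>
     (h \<cdot> g) \<cdot> f = h \<cdot> (g \<cdot> f)"
  using Comp_assoc by (auto simp: Hom_def)

text \<open>Composites are normalized to the right, so that an equation \<open>g \<cdot> f = k\<close> no longer matches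
  inside a longer composite; this is the form of it that does.\<close>

lemma rewrite_head:
  assumes "g \<cdot> f = k" "f \<in> Arr A" "g \<in> Arr A" "Dom A g = Cod A f" "h \<in> Arr A" "Cod A h = Dom A f"
  shows "g \<cdot> (f \<cdot> h) = k \<cdot> h"
  using assms assoc[of h f g] by simp

lemma isoI:
  assumes "f \<in> Arr A" "g \<in> Arr A" "Dom A g = Cod A f" "Cod A g = Dom A f"
    and "g \<cdot> f = Ide A (Dom A f)" "f \<cdot> g = Ide A (Cod A f)"
  shows "is_iso A f"
  using assms by (auto simp: is_iso_def Hom_def)

lemma isoE:
  assumes "is_iso A f"
  obtains g where "f \<in> Arr A" "g \<in> Arr A" "Dom A g = Cod A f" "Cod A g = Dom A f"
    "g \<cdot> f = Ide A (Dom A f)" "f \<cdot> g = Ide A (Cod A f)"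
  using assms by (auto simp: is_iso_def Hom_def)

lemma iso_Comp:
  assumes "is_iso A f" "is_iso A g" "Dom A g = Cod A f"
  shows "is_iso A (g \<cdot> f)"
proof -
  obtain f' where f: "f \<in> Arr A" "f' \<in> Arr A" "Dom A f' = Cod A f" "Cod A f' = Dom A f"
      "f' \<cdot> f = Ide A (Dom A f)" "f \<cdot> f' = Ide A (Cod A f)"
    using assms(1) by (rule isoE)
  obtain g' where g: "g \<in> Arr A" "g' \<in> Arr A" "Dom A g' = Cod A g" "Cod A g' = Dom A g"
      "g' \<cdot> g = Ide A (Dom A g)" "g \<cdot> g' = Ide A (Cod A g)"
    using assms(2) by (rule isoE)
  show ?thesis
    by (rule isoI[where g = "f' \<cdot> g'"])
      (use f g assms(3) in \<open>simp_all add: rewrite_head[OF g(5)] rewrite_head[OF f(6)]\<close>)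
qed

lemma iso_of_right_inverse:
  assumes f: "is_iso A f" and g: "g \<in> Arr A" "Cod A g = Dom A f"
    and fg: "f \<cdot> g = Ide A (Cod A f)"
  shows "is_iso A g"
proof -
  obtain f' where f': "f \<in> Arr A" "f' \<in> Arr A" "Dom A f' = Cod A f" "Cod A f' = Dom A f"
      "f' \<cdot> f = Ide A (Dom A f)" "f \<cdot> f' = Ide A (Cod A f)"
    using f by (rule isoE)
  have "g = f' \<cdot> (f \<cdot> g)" using f'(1-4) g rewrite_head[OF f'(5), of g] by simp
  also have "\<dots> = f'" using f' fg by simp
  finally have "g = f'" .
  then show ?thesis using f' by (intro isoI[where g = f]) auto
qed

lemma equalizer_arrs:
  assumes "is_equalizer A f g e"
  shows "f \<in> Arr A" "g \<in> Arr A" "Dom A g = Dom A f" "Cod A g = Cod A f"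
    "e \<in> Arr A" "Cod A e = Dom A f" "f \<cdot> e = g \<cdot> e"
  using assms by (auto simp: is_equalizer_def)

lemma equalizer_mono:
  assumes e: "is_equalizer A f g e" and hk: "h \<in> Arr A" "k \<in> Arr A"
    "Cod A h = Dom A e" "Cod A k = Dom A e" "Dom A h = Dom A k" "e \<cdot> h = e \<cdot> k"
  shows "h = k"
proof -
  note E = equalizer_arrs[OF e]
  have eh: "e \<cdot> h \<in> Arr A" "Cod A (e \<cdot> h) = Dom A f" "Dom A (e \<cdot> h) = Dom A h"
    using E hk(1,3) by simp_all
  have "f \<cdot> (e \<cdot> h) = g \<cdot> (e \<cdot> h)"
    using E(1-6) hk(1,3) rewrite_head[OF E(7), of h] by simp
  with e eh have "\<exists>!l. l \<in> Hom A (Dom A h) (Dom A e) \<and> e \<cdot> l = e \<cdot> h"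
    unfolding is_equalizer_def by metis
  moreover have "h \<in> Hom A (Dom A h) (Dom A e)" "k \<in> Hom A (Dom A h) (Dom A e)"
    using hk(1-5) by (simp_all add: Hom_def)
  ultimately show ?thesis using hk(6) by metis
qed

lemma equalizer_factor:
  assumes "is_equalizer A f g e" "h \<in> Arr A" "Cod A h = Dom A f" "f \<cdot> h = g \<cdot> h"
  obtains k where "k \<in> Arr A" "Dom A k = Dom A h" "Cod A k = Dom A e" "e \<cdot> k = h"
proof -
  have "\<exists>!k. k \<in> Hom A (Dom A h) (Dom A e) \<and> e \<cdot> k = h"
    using assms unfolding is_equalizer_def by blast
  then show thesis using that by (auto simp: Hom_def)
qed

lemma equalizerI:
  assumes "f \<in> Arr A" "g \<in> Arr A" "Dom A g = Dom A f" "Cod A g = Cod A f"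
    "e \<in> Arr A" "Cod A e = Dom A f" "f \<cdot> e = g \<cdot> e"
    and ex: "\<And>h. h \<in> Arr A \<Longrightarrow> Cod A h = Dom A f \<Longrightarrow> f \<cdot> h = g \<cdot> h \<Longrightarrow>
      \<exists>k. k \<in> Arr A \<and> Dom A k = Dom A h \<and> Cod A k = Dom A e \<and> e \<cdot> k = h"
    and mono: "\<And>h k. h \<in> Arr A \<Longrightarrow> k \<in> Arr A \<Longrightarrow> Dom A h = Dom A k \<Longrightarrow>
      Cod A h = Dom A e \<Longrightarrow> Cod A k = Dom A e \<Longrightarrow> e \<cdot> h = e \<cdot> k \<Longrightarrow> h = k"
  shows "is_equalizer A f g e"
  unfolding is_equalizer_def
proof (intro conjI ballI impI)
  fix h assume h: "h \<in> Arr A" and "Cod A h = Dom A f \<and> f \<cdot> h = g \<cdot> h"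
  then obtain k where "k \<in> Arr A" "Dom A k = Dom A h" "Cod A k = Dom A e" "e \<cdot> k = h"
    using ex by metis
  then show "\<exists>!k. k \<in> Hom A (Dom A h) (Dom A e) \<and> e \<cdot> k = h"
    by (intro ex1I[of _ k]) (auto simp: Hom_def intro: mono)
qed (use assms in auto)

lemma equalizers_iso:
  assumes e: "is_equalizer A f g e" and e': "is_equalizer A f g e'"
  obtains u where "is_iso A u" "Dom A u = Dom A e'" "Cod A u = Dom A e" "e \<cdot> u = e'"
proof -
  note E = equalizer_arrs[OF e] and E' = equalizer_arrs[OF e']
  obtain u where u: "u \<in> Arr A" "Dom A u = Dom A e'" "Cod A u = Dom A e" "e \<cdot> u = e'"
    by (rule equalizer_factor[OF e E'(5,6,7)])
  obtain w where w: "w \<in> Arr A" "Dom A w = Dom A e" "Cod A w = Dom A e'" "e' \<cdot> w = e"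
    by (rule equalizer_factor[OF e' E(5,6,7)])
  have "w \<cdot> u = Ide A (Dom A e')"
    by (rule equalizer_mono[OF e'])
      (use u w E E' rewrite_head[OF w(4), of u] in \<open>simp_all\<close>)
  moreover have "u \<cdot> w = Ide A (Dom A e)"
    by (rule equalizer_mono[OF e])
      (use u w E E' rewrite_head[OF u(4), of w] in \<open>simp_all\<close>)
  ultimately have "is_iso A u"
    using u w by (intro isoI[of u w]) auto
  then show ?thesis using u that by blast
qed

lemma equalizer_Comp_iso:
  assumes e: "is_equalizer A f g e" and u: "is_iso A u" "Cod A u = Dom A e"
  shows "is_equalizer A f g (e \<cdot> u)"
proof -
  note E = equalizer_arrs[OF e]
  obtain w where w: "u \<in> Arr A" "w \<in> Arr A" "Dom A w = Cod A u" "Cod A w = Dom A u"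
      "w \<cdot> u = Ide A (Dom A u)" "u \<cdot> w = Ide A (Cod A u)"
    using u(1) by (rule isoE)
  show ?thesis
  proof (rule equalizerI)
    show "f \<cdot> (e \<cdot> u) = g \<cdot> (e \<cdot> u)"
      using E w u by (simp add: rewrite_head[OF E(7)])
  next
    fix h assume h: "h \<in> Arr A" "Cod A h = Dom A f" "f \<cdot> h = g \<cdot> h"
    obtain k where k: "k \<in> Arr A" "Dom A k = Dom A h" "Cod A k = Dom A e" "e \<cdot> k = h"
      using equalizer_factor[OF e h] by blast
    show "\<exists>k. k \<in> Arr A \<and> Dom A k = Dom A h \<and> Cod A k = Dom A (e \<cdot> u) \<and> (e \<cdot> u) \<cdot> k = h"
      using E w u k by (intro exI[of _ "w \<cdot> k"]) (simp add: rewrite_head[OF w(6)])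
  next
    fix h k assume hk: "h \<in> Arr A" "k \<in> Arr A" "Dom A h = Dom A k" "Cod A h = Dom A (e \<cdot> u)"
      "Cod A k = Dom A (e \<cdot> u)" "(e \<cdot> u) \<cdot> h = (e \<cdot> u) \<cdot> k"
    have "u \<cdot> h = u \<cdot> k"
      by (rule equalizer_mono[OF e]) (use hk E w u in \<open>simp_all\<close>)
    then have "w \<cdot> (u \<cdot> h) = w \<cdot> (u \<cdot> k)" by simp
    then show "h = k"
      using hk E w u by (simp add: rewrite_head[OF w(5)])
  qed (use E w u in \<open>simp_all\<close>)
qed

text \<open>The factorization of \<open>h\<close> is \<open>s \<cdot> h\<close>, because \<open>h = t g h = t f h = e s h\<close>.\<close>

lemma split_equalizer:
  assumes "f \<in> Arr A" "g \<in> Arr A" "Dom A g = Dom A f" "Cod A g = Cod A f"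
    "e \<in> Arr A" "Cod A e = Dom A f" "f \<cdot> e = g \<cdot> e"
    and s: "s \<in> Arr A" "Dom A s = Dom A f" "Cod A s = Dom A e" "s \<cdot> e = Ide A (Dom A e)"
    and t: "t \<in> Arr A" "Dom A t = Cod A f" "Cod A t = Dom A f" "t \<cdot> f = e \<cdot> s"
      "t \<cdot> g = Ide A (Dom A f)"
  shows "is_equalizer A f g e"
proof (rule equalizerI)
  fix h assume h: "h \<in> Arr A" "Cod A h = Dom A f" "f \<cdot> h = g \<cdot> h"
  have "h = t \<cdot> (g \<cdot> h)" using assms h rewrite_head[OF t(5)] by simp
  also have "\<dots> = t \<cdot> (f \<cdot> h)" using h by simp
  also have "\<dots> = e \<cdot> (s \<cdot> h)" using assms h(1,2) rewrite_head[OF t(4)] by simp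
  finally show "\<exists>k. k \<in> Arr A \<and> Dom A k = Dom A h \<and> Cod A k = Dom A e \<and> e \<cdot> k = h"
    using assms h by (intro exI[of _ "s \<cdot> h"]) simp
next
  fix h k assume hk: "h \<in> Arr A" "k \<in> Arr A" "Dom A h = Dom A k" "Cod A h = Dom A e"
      "Cod A k = Dom A e" "e \<cdot> h = e \<cdot> k"
  have "s \<cdot> (e \<cdot> h) = h" "s \<cdot> (e \<cdot> k) = k"
    using assms(5,6) s hk(1-5) rewrite_head[OF s(4), of h] rewrite_head[OF s(4), of k]
    by simp_all
  then show "h = k" using hk(6) by metis
qed (use assms in auto)

end

lemma functor_simps:
  assumes "is_functor A B F"
  shows "X \<in> Obj A \<Longrightarrow> ob F X \<in> Obj B"
    and "f \<in> Arr A \<Longrightarrow> ar F f \<in> Arr B"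
    and "f \<in> Arr A \<Longrightarrow> Dom B (ar F f) = ob F (Dom A f)"
    and "f \<in> Arr A \<Longrightarrow> Cod B (ar F f) = ob F (Cod A f)"
    and "X \<in> Obj A \<Longrightarrow> ar F (Ide A X) = Ide B (ob F X)"
    and "f \<in> Arr A \<Longrightarrow> g \<in> Arr A \<Longrightarrow> Dom A g = Cod A f \<Longrightarrow>
      ar F (g \<cdot>\<^bsub>A\<^esub> f) = ar F g \<cdot>\<^bsub>B\<^esub> ar F f"
  using assms by (auto simp: is_functor_def Hom_def)

lemma functor_categories:
  assumes "is_functor A B F"
  shows "category A" "category B"
  using assms by (auto simp: is_functor_def)

lemma functor_iso:
  assumes F: "is_functor A B F" and f: "is_iso A f"
  shows "is_iso B (ar F f)"
proof -
  interpret A: category A by (rule functor_categories[OF F])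
  interpret B: category B by (rule functor_categories[OF F])
  note [simp] = functor_simps[OF F]
  obtain g where g: "f \<in> Arr A" "g \<in> Arr A" "Dom A g = Cod A f" "Cod A g = Dom A f"
      "g \<cdot>\<^bsub>A\<^esub> f = Ide A (Dom A f)" "f \<cdot>\<^bsub>A\<^esub> g = Ide A (Cod A f)"
    using f by (rule A.isoE)
  have "ar F g \<cdot>\<^bsub>B\<^esub> ar F f = Ide B (ob F (Dom A f))"
    "ar F f \<cdot>\<^bsub>B\<^esub> ar F g = Ide B (ob F (Cod A f))"
    using g by (simp_all flip: functor_simps(5,6)[OF F])
  then show ?thesis
    using g by (intro B.isoI[where g = "ar F g"]) simp_all
qed

lemma functor_coreflexive_pair:
  assumes F: "is_functor A B F" and fg: "coreflexive_pair A f g"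
  shows "coreflexive_pair B (ar F f) (ar F g)"
proof -
  interpret A: category A by (rule functor_categories[OF F])
  note [simp] = functor_simps[OF F]
  obtain r where r: "f \<in> Arr A" "g \<in> Arr A" "Dom A g = Dom A f" "Cod A g = Cod A f"
      "r \<in> Arr A" "Dom A r = Cod A f" "Cod A r = Dom A f"
      "r \<cdot>\<^bsub>A\<^esub> f = Ide A (Dom A f)" "r \<cdot>\<^bsub>A\<^esub> g = Ide A (Dom A f)"
    using fg by (auto simp: coreflexive_pair_def Hom_def)
  have "ar F r \<cdot>\<^bsub>B\<^esub> ar F f = Ide B (ob F (Dom A f))"
    "ar F r \<cdot>\<^bsub>B\<^esub> ar F g = Ide B (ob F (Dom A f))"
    using r by (simp_all flip: functor_simps(5,6)[OF F])
  then show ?thesis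
    unfolding coreflexive_pair_def
    by (intro conjI bexI[of _ "ar F r"]) (use r in \<open>simp_all add: Hom_def\<close>)
qed

text \<open>Pointwise inverses are automatically natural: conjugate the naturality square of \<open>\<alpha>\<close>.\<close>

lemma invertible_trans_iff_iso:
  "invertible_trans A B F G \<alpha> \<longleftrightarrow> nat_trans A B F G \<alpha> \<and> (\<forall>X \<in> Obj A. is_iso B (\<alpha> X))"
proof (cases "nat_trans A B F G \<alpha>")
  case \<alpha>: True
  then have F: "is_functor A B F" and G: "is_functor A B G"
    by (auto simp: nat_trans_def)
  interpret A: category A by (rule functor_categories[OF F])
  interpret B: category B by (rule functor_categories[OF F])
  note [simp] = functor_simps[OF F] functor_simps[OF G]
  have \<alpha>_arr [simp]: "\<alpha> X \<in> Arr B" "Dom B (\<alpha> X) = ob F X" "Cod B (\<alpha> X) = ob G X"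
    if "X \<in> Obj A" for X
    using nat_trans_in_Hom[OF \<alpha> that] by (auto simp: Hom_def)
  show ?thesis
  proof (intro iffI conjI \<alpha> ballI)
    fix X assume "invertible_trans A B F G \<alpha>" and X: "X \<in> Obj A"
    then obtain \<beta> where \<beta>: "nat_trans A B G F \<beta>"
      "\<beta> X \<cdot>\<^bsub>B\<^esub> \<alpha> X = Ide B (ob F X)" "\<alpha> X \<cdot>\<^bsub>B\<^esub> \<beta> X = Ide B (ob G X)"
      by (auto simp: invertible_trans_def)
    then show "is_iso B (\<alpha> X)"
      using X nat_trans_in_Hom[OF \<beta>(1) X] by (intro B.isoI[of _ "\<beta> X"]) (auto simp: Hom_def)
  next
    assume iso: "nat_trans A B F G \<alpha> \<and> (\<forall>X\<in>Obj A. is_iso B (\<alpha> X))"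
    have "\<forall>X\<in>Obj A. \<exists>b. b \<in> Arr B \<and> Dom B b = ob G X \<and> Cod B b = ob F X \<and>
        b \<cdot>\<^bsub>B\<^esub> \<alpha> X = Ide B (ob F X) \<and> \<alpha> X \<cdot>\<^bsub>B\<^esub> b = Ide B (ob G X)"
      using iso by (auto simp: is_iso_def Hom_def)
    then obtain \<beta> where \<beta>': "\<forall>X\<in>Obj A. \<beta> X \<in> Arr B \<and> Dom B (\<beta> X) = ob G X \<and> Cod B (\<beta> X) = ob F X \<and>
        \<beta> X \<cdot>\<^bsub>B\<^esub> \<alpha> X = Ide B (ob F X) \<and> \<alpha> X \<cdot>\<^bsub>B\<^esub> \<beta> X = Ide B (ob G X)"
      by metis
    then have \<beta>: "\<beta> X \<in> Arr B" "Dom B (\<beta> X) = ob G X" "Cod B (\<beta> X) = ob F X"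
        "\<beta> X \<cdot>\<^bsub>B\<^esub> \<alpha> X = Ide B (ob F X)" "\<alpha> X \<cdot>\<^bsub>B\<^esub> \<beta> X = Ide B (ob G X)" if "X \<in> Obj A" for X
      using that by auto
    have "nat_trans A B G F \<beta>"
      unfolding nat_trans_def
    proof (intro conjI ballI F G)
      fix X assume "X \<in> Obj A" then show "\<beta> X \<in> Hom B (ob G X) (ob F X)"
        using \<beta> by (auto simp: Hom_def)
    next
      fix f assume f: "f \<in> Arr A"
      let ?X = "Dom A f" and ?Y = "Cod A f"
      have nat: "\<alpha> ?Y \<cdot>\<^bsub>B\<^esub> ar F f = ar G f \<cdot>\<^bsub>B\<^esub> \<alpha> ?X"
        using \<alpha> f by (simp add: nat_trans_def)
      have "\<beta> ?Y \<cdot>\<^bsub>B\<^esub> ar G f = \<beta> ?Y \<cdot>\<^bsub>B\<^esub> ((ar G f \<cdot>\<^bsub>B\<^esub> \<alpha> ?X) \<cdot>\<^bsub>B\<^esub> \<beta> ?X)"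
        using f \<beta> by simp
      also have "\<dots> = \<beta> ?Y \<cdot>\<^bsub>B\<^esub> (\<alpha> ?Y \<cdot>\<^bsub>B\<^esub> (ar F f \<cdot>\<^bsub>B\<^esub> \<beta> ?X))"
        unfolding nat[symmetric] using f \<beta> by simp
      also have "\<dots> = ar F f \<cdot>\<^bsub>B\<^esub> \<beta> ?X"
        using f \<beta> by (simp add: B.rewrite_head[OF \<beta>(4)])
      finally show "\<beta> ?Y \<cdot>\<^bsub>B\<^esub> ar G f = ar F f \<cdot>\<^bsub>B\<^esub> \<beta> ?X" .
    qed
    then show "invertible_trans A B F G \<alpha>"
      using \<alpha> \<beta> by (auto simp: invertible_trans_def)
  qed
qed (simp add: invertible_trans_def)

text \<open>A right adjoint is determined by its counit components: every equation between arrows into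
  \<open>G Y\<close> can be tested after applying \<open>F\<close> and composing with \<open>v Y\<close>. Functoriality of \<open>G\<close>,
  naturality of \<open>u\<close> and the second triangle identity are equations of this kind. The couniversal
  factorization of \<open>f : F X \<rightarrow> Y\<close> is \<open>ar G f \<cdot> u X\<close>, so only its uniqueness has to be assumed.\<close>

lemma adjunction_of_couniversal_arrows:
  assumes F: "is_functor A B F"
    and obG: "\<And>Y. Y \<in> Obj B \<Longrightarrow> ob G Y \<in> Obj A"
    and v: "\<And>Y. Y \<in> Obj B \<Longrightarrow> v Y \<in> Hom B (ob F (ob G Y)) Y"
    and arG: "\<And>f. f \<in> Arr B \<Longrightarrow> ar G f \<in> Hom A (ob G (Dom B f)) (ob G (Cod B f))"
    and v_nat: "\<And>f. f \<in> Arr B \<Longrightarrow> v (Cod B f) \<cdot>\<^bsub>B\<^esub> ar F (ar G f) = f \<cdot>\<^bsub>B\<^esub> v (Dom B f)"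
    and u: "\<And>X. X \<in> Obj A \<Longrightarrow> u X \<in> Hom A X (ob G (ob F X))"
    and triangle: "\<And>X. X \<in> Obj A \<Longrightarrow> v (ob F X) \<cdot>\<^bsub>B\<^esub> ar F (u X) = Ide B (ob F X)"
    and inj: "\<And>Y g h. Y \<in> Obj B \<Longrightarrow> g \<in> Arr A \<Longrightarrow> h \<in> Arr A \<Longrightarrow> Dom A g = Dom A h \<Longrightarrow>
      Cod A g = ob G Y \<Longrightarrow> Cod A h = ob G Y \<Longrightarrow> v Y \<cdot>\<^bsub>B\<^esub> ar F g = v Y \<cdot>\<^bsub>B\<^esub> ar F h \<Longrightarrow> g = h"
  shows "adjunction A B F G u v"
proof -
  interpret A: category A by (rule functor_categories[OF F])
  interpret B: category B by (rule functor_categories[OF F])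
  note [simp] = functor_simps[OF F] obG comp_funct_def id_funct_def
  have [simp]: "v Y \<in> Arr B" "Dom B (v Y) = ob F (ob G Y)" "Cod B (v Y) = Y" if "Y \<in> Obj B" for Y
    using v[OF that] by (auto simp: Hom_def)
  have [simp]: "u X \<in> Arr A" "Dom A (u X) = X" "Cod A (u X) = ob G (ob F X)" if "X \<in> Obj A" for X
    using u[OF that] by (auto simp: Hom_def)
  have [simp]: "ar G f \<in> Arr A" "Dom A (ar G f) = ob G (Dom B f)" "Cod A (ar G f) = ob G (Cod B f)"
    if "f \<in> Arr B" for f
    using arG[OF that] by (auto simp: Hom_def)
  have vG: "v Y \<cdot>\<^bsub>B\<^esub> ar F (ar G f) = f \<cdot>\<^bsub>B\<^esub> v (Dom B f)"
    if "f \<in> Arr B" "Cod B f = Y" for f Y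
    using v_nat that by auto
  have vG': "v Y \<cdot>\<^bsub>B\<^esub> (ar F (ar G f) \<cdot>\<^bsub>B\<^esub> h) = f \<cdot>\<^bsub>B\<^esub> (v (Dom B f) \<cdot>\<^bsub>B\<^esub> h)"
    if "f \<in> Arr B" "Cod B f = Y" "h \<in> Arr B" "Cod B h = ob F (ob G (Dom B f))" for f Y h
    using that by (auto simp: B.rewrite_head[OF vG])
  have G: "is_functor B A G"
    unfolding is_functor_def
  proof (intro conjI ballI impI)
    fix Y assume Y: "Y \<in> Obj B"
    show "ar G (Ide B Y) = Ide A (ob G Y)"
      by (rule inj[OF Y]) (use Y in \<open>simp_all add: vG\<close>)
  next
    fix f g assume fg: "f \<in> Arr B" "g \<in> Arr B" "Cod B f = Dom B g"
    show "ar G (g \<cdot>\<^bsub>B\<^esub> f) = ar G g \<cdot>\<^bsub>A\<^esub> ar G f"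
      by (rule inj[of "Cod B g"]) (use fg in \<open>simp_all add: vG vG'\<close>)
  qed (simp_all add: A.category_axioms B.category_axioms Hom_def)
  have u_nat: "nat_trans A A id_funct (G \<circ>\<^sub>F F) u"
    unfolding nat_trans_def
  proof (intro conjI ballI)
    show "is_functor A A id_funct" by (auto simp: is_functor_def Hom_def A.category_axioms)
    show "is_functor A A (G \<circ>\<^sub>F F)" by (rule is_functor_comp[OF F G])
    fix f assume f: "f \<in> Arr A"
    have "u (Cod A f) \<cdot>\<^bsub>A\<^esub> f = ar G (ar F f) \<cdot>\<^bsub>A\<^esub> u (Dom A f)"
      by (rule inj[of "ob F (Cod A f)"])
        (use f in \<open>simp_all add: vG' triangle B.rewrite_head[OF triangle]\<close>)
    then show "u (Cod A f) \<cdot>\<^bsub>A\<^esub> ar id_funct f = ar (G \<circ>\<^sub>F F) f \<cdot>\<^bsub>A\<^esub> u (Dom A f)"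
      by simp
  qed (simp add: Hom_def)
  have v_nat': "nat_trans B B (F \<circ>\<^sub>F G) id_funct v"
    unfolding nat_trans_def
  proof (intro conjI ballI)
    show "is_functor B B id_funct" by (auto simp: is_functor_def Hom_def B.category_axioms)
    show "is_functor B B (F \<circ>\<^sub>F G)" by (rule is_functor_comp[OF G F])
  qed (simp_all add: Hom_def vG)
  have "ar G (v Y) \<cdot>\<^bsub>A\<^esub> u (ob G Y) = Ide A (ob G Y)" if Y: "Y \<in> Obj B" for Y
    by (rule inj[OF Y]) (use Y in \<open>simp_all add: vG' triangle\<close>)
  then show ?thesis
    using F G u_nat v_nat' triangle by (simp add: adjunction_def)
qed

section \<open>Coalgebras of a comonad\<close>

locale comonad_on = category A for A :: "('o, 'a) cat" (structure) +
  fixes T :: "('o, 'a) comonad_data"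
  assumes comonad: "comonad A T"
begin

lemma Fun_functor: "is_functor A A (Fun T)"
  using comonad by (simp add: comonad_def)

lemmas [simp] = functor_simps[OF Fun_functor]

lemma comult_arr [simp]:
  assumes "X \<in> Obj A"
  shows "comult T X \<in> Arr A" "Dom A (comult T X) = ob (Fun T) X"
    "Cod A (comult T X) = ob (Fun T) (ob (Fun T) X)"
  using comonad assms by (auto simp: comonad_def nat_trans_def Hom_def comp_funct_def)

lemma counit_arr [simp]:
  assumes "X \<in> Obj A"
  shows "counit T X \<in> Arr A" "Dom A (counit T X) = ob (Fun T) X" "Cod A (counit T X) = X"
  using comonad assms by (auto simp: comonad_def nat_trans_def Hom_def id_funct_def)

lemma comult_nat [simp]:
  "f \<in> Arr A \<Longrightarrow> Cod A f = Y \<Longrightarrow>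
    comult T Y \<cdot> ar (Fun T) f = ar (Fun T) (ar (Fun T) f) \<cdot> comult T (Dom A f)"
  using comonad by (auto simp: comonad_def nat_trans_def comp_funct_def)

lemma counit_nat [simp]:
  "f \<in> Arr A \<Longrightarrow> Cod A f = Y \<Longrightarrow> counit T Y \<cdot> ar (Fun T) f = f \<cdot> counit T (Dom A f)"
  using comonad by (auto simp: comonad_def nat_trans_def id_funct_def)

lemma comonad_laws [simp]:
  assumes "X \<in> Obj A"
  shows "comult T (ob (Fun T) X) \<cdot> comult T X = ar (Fun T) (comult T X) \<cdot> comult T X"
    "counit T (ob (Fun T) X) \<cdot> comult T X = Ide A (ob (Fun T) X)"
    "ar (Fun T) (counit T X) \<cdot> comult T X = Ide A (ob (Fun T) X)"
  using comonad assms by (auto simp: comonad_def)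

lemmas comonad_reassoc [simp] =
  rewrite_head[OF comult_nat] rewrite_head[OF counit_nat]
  rewrite_head[OF comonad_laws(1)] rewrite_head[OF comonad_laws(2)]
  rewrite_head[OF comonad_laws(3)]

lemma is_coalg_iff:
  "is_coalg A T (X, c) \<longleftrightarrow> X \<in> Obj A \<and> c \<in> Arr A \<and> Dom A c = X \<and> Cod A c = ob (Fun T) X \<and>
    comult T X \<cdot> c = ar (Fun T) c \<cdot> c \<and> counit T X \<cdot> c = Ide A X"
  by (auto simp: is_coalg_def Hom_def)

lemma is_coalg_mor_iff:
  "is_coalg_mor A T ((X, c), f, (Y, d)) \<longleftrightarrow> is_coalg A T (X, c) \<and> is_coalg A T (Y, d) \<and>
    f \<in> Arr A \<and> Dom A f = X \<and> Cod A f = Y \<and> d \<cdot> f = ar (Fun T) f \<cdot> c"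
  by (auto simp: is_coalg_mor_def Hom_def)

lemma coalg_cat_simps [simp]:
  "p \<in> Obj (coalg_cat A T) \<longleftrightarrow> is_coalg A T p"
  "\<phi> \<in> Arr (coalg_cat A T) \<longleftrightarrow> is_coalg_mor A T \<phi>"
  "Dom (coalg_cat A T) (p, f, q) = p"
  "Cod (coalg_cat A T) (p, f, q) = q"
  "Ide (coalg_cat A T) p = (p, Ide A (fst p), p)"
  "(q, g, r) \<cdot>\<^bsub>coalg_cat A T\<^esub> (p, f, q') = (p, g \<cdot> f, r)"
  by (simp_all add: coalg_cat_def)

lemma coalg_mor_Comp:
  assumes "is_coalg_mor A T (p, f, q)" "is_coalg_mor A T (q, g, r)"
  shows "is_coalg_mor A T (p, g \<cdot> f, r)"
proof (cases p; cases q; cases r)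
  fix X c Y d Z b
  assume [simp]: "p = (X, c)" "q = (Y, d)" "r = (Z, b)"
  have f: "f \<in> Arr A" "Dom A f = X" "Cod A f = Y" "X \<in> Obj A" "c \<in> Arr A" "Dom A c = X"
      "Cod A c = ob (Fun T) X"  "d \<in> Arr A" "Dom A d = Y" "Cod A d = ob (Fun T) Y"
      "d \<cdot> f = ar (Fun T) f \<cdot> c"
    and g: "g \<in> Arr A" "Dom A g = Y" "Cod A g = Z" "b \<in> Arr A" "Dom A b = Z" 
      "Cod A b = ob (Fun T) Z" "b \<cdot> g = ar (Fun T) g \<cdot> d"
    using assms by (simp_all add: is_coalg_mor_iff is_coalg_iff)
  have "b \<cdot> (g \<cdot> f) = ar (Fun T) (g \<cdot> f) \<cdot> c"
    using f g by (simp add: rewrite_head[OF g(7)])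
  then show ?thesis
    using assms by (simp add: is_coalg_mor_iff)
qed

lemma coalg_mor_Ide: "is_coalg A T p \<Longrightarrow> is_coalg_mor A T (p, Ide A (fst p), p)"
  by (cases p) (simp add: is_coalg_mor_iff is_coalg_iff)

lemma coalg_category: "category (coalg_cat A T)"
proof
  fix \<phi> assume "\<phi> \<in> Arr (coalg_cat A T)"
  then show "Dom (coalg_cat A T) \<phi> \<in> Obj (coalg_cat A T)"
    "Cod (coalg_cat A T) \<phi> \<in> Obj (coalg_cat A T)"
    by (auto simp: is_coalg_mor_def coalg_cat_def)
next
  fix p assume "p \<in> Obj (coalg_cat A T)"
  then show "Ide (coalg_cat A T) p \<in> Hom (coalg_cat A T) p p"
    by (auto simp: Hom_def coalg_mor_Ide)
next
  fix \<phi> \<psi> p q r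
  assume "\<phi> \<in> Hom (coalg_cat A T) p q" "\<psi> \<in> Hom (coalg_cat A T) q r"
  then show "\<psi> \<cdot>\<^bsub>coalg_cat A T\<^esub> \<phi> \<in> Hom (coalg_cat A T) p r"
    by (cases \<phi>; cases \<psi>) (auto simp: Hom_def intro: coalg_mor_Comp)
next
  fix \<phi> p q
  assume "\<phi> \<in> Hom (coalg_cat A T) p q"
  then show "\<phi> \<cdot>\<^bsub>coalg_cat A T\<^esub> Ide (coalg_cat A T) p = \<phi>"
    "Ide (coalg_cat A T) q \<cdot>\<^bsub>coalg_cat A T\<^esub> \<phi> = \<phi>"
    by (cases \<phi>; cases p; cases q; simp add: Hom_def is_coalg_mor_iff; fastforce)+
next
  fix \<phi> \<psi> \<chi> n p q r
  assume "\<phi> \<in> Hom (coalg_cat A T) n p" "\<psi> \<in> Hom (coalg_cat A T) p q"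
    "\<chi> \<in> Hom (coalg_cat A T) q r"
  then show "\<chi> \<cdot>\<^bsub>coalg_cat A T\<^esub> \<psi> \<cdot>\<^bsub>coalg_cat A T\<^esub> \<phi>
      = \<chi> \<cdot>\<^bsub>coalg_cat A T\<^esub> (\<psi> \<cdot>\<^bsub>coalg_cat A T\<^esub> \<phi>)"
    by (cases \<phi>; cases \<psi>; cases \<chi>; cases n; cases p; cases q; cases r)
      (auto simp: Hom_def is_coalg_mor_iff)
qed

text \<open>An inverse \<open>g\<close> of the arrow underlying a coalgebra morphism is a coalgebra morphism again:
  \<open>T g \<cdot> d = T g \<cdot> d \<cdot> f \<cdot> g = T g \<cdot> T f \<cdot> c \<cdot> g = c \<cdot> g\<close>.\<close>

lemma coalg_iso_iff:
  assumes "is_coalg_mor A T (p, f, q)"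
  shows "is_iso (coalg_cat A T) (p, f, q) \<longleftrightarrow> is_iso A f"
proof (cases p; cases q)
  fix X c Y d
  assume [simp]: "p = (X, c)" "q = (Y, d)"
  have f: "f \<in> Arr A" "Dom A f = X" "Cod A f = Y" "X \<in> Obj A" "c \<in> Arr A" "Dom A c = X"
      "Cod A c = ob (Fun T) X"  "d \<in> Arr A" "Dom A d = Y" "Cod A d = ob (Fun T) Y" "Y \<in> Obj A"
      "d \<cdot> f = ar (Fun T) f \<cdot> c"
    using assms by (simp_all add: is_coalg_mor_iff is_coalg_iff)
  show ?thesis
  proof
    assume "is_iso (coalg_cat A T) (p, f, q)"
    then obtain g where "is_coalg_mor A T (q, g, p)" "g \<cdot> f = Ide A X" "f \<cdot> g = Ide A Y"
      by (force simp: is_iso_def Hom_def)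
    then show "is_iso A f"
      using f by (intro isoI[of f g]) (auto simp: is_coalg_mor_iff)
  next
    assume "is_iso A f"
    then obtain g where g: "g \<in> Arr A" "Dom A g = Y" "Cod A g = X"
        "g \<cdot> f = Ide A X" "f \<cdot> g = Ide A Y"
      using f by (auto elim: isoE)
    have Tgf: "ar (Fun T) g \<cdot> ar (Fun T) f = Ide A (ob (Fun T) X)"
      using f g by (simp flip: functor_simps(5,6)[OF Fun_functor])
    have "ar (Fun T) g \<cdot> d = ar (Fun T) g \<cdot> (d \<cdot> (f \<cdot> g))"
      using f g by simp
    also have "\<dots> = c \<cdot> g"
      using f g(1-3) rewrite_head[OF f(12), of g] by (simp add: rewrite_head[OF Tgf])
    finally have "is_coalg_mor A T (q, g, p)"
      using assms g by (simp add: is_coalg_mor_iff)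
    then show "is_iso (coalg_cat A T) (p, f, q)"
      using assms f g by (auto simp: is_iso_def Hom_def intro!: bexI[of _ "(q, g, p)"])
  qed
qed

lemma cofree_coalg: "X \<in> Obj A \<Longrightarrow> is_coalg A T (cofree T X)"
  by (simp add: cofree_def is_coalg_iff)

lemma cofree_mor:
  assumes "f \<in> Arr A" "Dom A f = X" "Cod A f = Y"
  shows "is_coalg_mor A T (cofree T X, ar (Fun T) f, cofree T Y)"
  using assms by (auto simp: cofree_def is_coalg_iff is_coalg_mor_iff)

text \<open>Together with \<open>mor_to_cofree_eq_coextension\<close> this is the cofree property: coalgebra morphisms
  \<open>(X, c) \<rightarrow> cofree T Y\<close> correspond to arrows \<open>X \<rightarrow> Y\<close>, by \<open>f \<mapsto> T f \<cdot> c\<close> in one direction and by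
  composition with the counit in the other.\<close>

lemma coextension_mor:
  assumes c: "is_coalg A T (X, c)" and f: "f \<in> Arr A" "Dom A f = X" "Cod A f = Y"
  shows "is_coalg_mor A T ((X, c), ar (Fun T) f \<cdot> c, cofree T Y)"
proof -
  have c': "X \<in> Obj A" "c \<in> Arr A" "Dom A c = X" "Cod A c = ob (Fun T) X"
    "comult T X \<cdot> c = ar (Fun T) c \<cdot> c"
    using c by (simp_all add: is_coalg_iff)
  show ?thesis
    using c f c' cofree_coalg[of Y] by (auto simp: is_coalg_mor_iff cofree_def)
qed

lemma mor_to_cofree_eq_coextension:
  assumes "is_coalg_mor A T ((X, c), g, cofree T Y)" and Y: "Y \<in> Obj A"
  shows "g = ar (Fun T) (counit T Y \<cdot> g) \<cdot> c"
proof -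
  have g: "g \<in> Arr A" "Dom A g = X" "Cod A g = ob (Fun T) Y" "X \<in> Obj A" "c \<in> Arr A" "Dom A c = X"
      "Cod A c = ob (Fun T) X" "comult T Y \<cdot> g = ar (Fun T) g \<cdot> c"
    using assms by (simp_all add: cofree_def is_coalg_mor_iff is_coalg_iff)
  have "ar (Fun T) (counit T Y \<cdot> g) \<cdot> c = ar (Fun T) (counit T Y) \<cdot> (comult T Y \<cdot> g)"
    using g Y by simp
  also have "\<dots> = g" using g(1-7) Y by simp
  finally show ?thesis ..
qed

text \<open>The coaction \<open>a\<close> on the equalizer is the factorization of \<open>c \<cdot> e\<close> through \<open>T e\<close>, which exists
  because \<open>T e\<close> is an equalizer. The coalgebra laws of \<open>a\<close> are inherited from those of \<open>c\<close>, since
  \<open>T T e\<close> and \<open>e\<close> are monic; a factorization through \<open>e\<close> is a coalgebra morphism because \<open>T e\<close>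
  is monic.\<close>

lemma coalg_equalizer_of_preserved:
  assumes f: "is_coalg_mor A T (p, f, q)" and g: "is_coalg_mor A T (p, g, q)"
    and e: "is_equalizer A f g e"
    and Te: "is_equalizer A (ar (Fun T) f) (ar (Fun T) g) (ar (Fun T) e)"
    and TTe: "is_equalizer A (ar (Fun T) (ar (Fun T) f)) (ar (Fun T) (ar (Fun T) g))
      (ar (Fun T) (ar (Fun T) e))"
  obtains a where "is_equalizer (coalg_cat A T) (p, f, q) (p, g, q) ((Dom A e, a), e, p)"
proof -
  interpret coalg: category "coalg_cat A T" by (rule coalg_category)
  obtain X c Y d where pq [simp]: "p = (X, c)" "q = (Y, d)"
    by (cases p; cases q) auto
  have f': "f \<in> Arr A" "Dom A f = X" "Cod A f = Y" "X \<in> Obj A" "c \<in> Arr A" "Dom A c = X"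
      "Cod A c = ob (Fun T) X"  "d \<in> Arr A" "Dom A d = Y" "Cod A d = ob (Fun T) Y" "Y \<in> Obj A"
    and fd: "d \<cdot> f = ar (Fun T) f \<cdot> c"
    and c_coassoc: "comult T X \<cdot> c = ar (Fun T) c \<cdot> c" and c_counit: "counit T X \<cdot> c = Ide A X"
    using f by (simp_all add: is_coalg_mor_iff is_coalg_iff)
  have g': "g \<in> Arr A" "Dom A g = X" "Cod A g = Y" and gd: "d \<cdot> g = ar (Fun T) g \<cdot> c"
    using g by (simp_all add: is_coalg_mor_iff)
  have e': "e \<in> Arr A" "Cod A e = X" "f \<cdot> e = g \<cdot> e"
    using equalizer_arrs[OF e] f' by simp_all
  have "ar (Fun T) f \<cdot> (c \<cdot> e) = d \<cdot> (f \<cdot> e)"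
    using f' e'(1,2) rewrite_head[OF fd, of e] by simp
  also have "\<dots> = ar (Fun T) g \<cdot> (c \<cdot> e)"
    unfolding e' using f' g' e'(1,2) rewrite_head[OF gd, of e] by simp
  finally have "ar (Fun T) f \<cdot> (c \<cdot> e) = ar (Fun T) g \<cdot> (c \<cdot> e)" .
  then obtain a where a: "a \<in> Arr A" "Dom A a = Dom A e" "Cod A a = ob (Fun T) (Dom A e)"
      and ea: "ar (Fun T) e \<cdot> a = c \<cdot> e"
    using equalizer_factor[OF Te, of "c \<cdot> e"] f' e'(1,2) by force
  have ea': "ar (Fun T) e \<cdot> (a \<cdot> h) = c \<cdot> (e \<cdot> h)"
    if "h \<in> Arr A" "Cod A h = Dom A e" for h
    using rewrite_head[OF ea, of h] that a e'(1,2) f' by simp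
  have TTea: "ar (Fun T) (ar (Fun T) e) \<cdot> ar (Fun T) a = ar (Fun T) c \<cdot> ar (Fun T) e"
    using arg_cong[OF ea, of "ar (Fun T)"] a e'(1,2) f' by simp
  have "comult T (Dom A e) \<cdot> a = ar (Fun T) a \<cdot> a"
  proof (rule equalizer_mono[OF TTe])
    have "ar (Fun T) (ar (Fun T) e) \<cdot> (comult T (Dom A e) \<cdot> a)
        = comult T X \<cdot> (ar (Fun T) e \<cdot> a)"
      using a e'(1,2) f'(4) by simp
    also have "\<dots> = ar (Fun T) c \<cdot> (c \<cdot> e)"
      unfolding ea using f' e'(1,2) by (simp add: rewrite_head[OF c_coassoc])
    also have "\<dots> = ar (Fun T) (ar (Fun T) e) \<cdot> (ar (Fun T) a \<cdot> a)"
      using a e'(1,2) f' by (simp add: rewrite_head[OF TTea] ea)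
    finally show "ar (Fun T) (ar (Fun T) e) \<cdot> (comult T (Dom A e) \<cdot> a)
        = ar (Fun T) (ar (Fun T) e) \<cdot> (ar (Fun T) a \<cdot> a)" .
  qed (use a e'(1,2) in simp_all)
  moreover have "counit T (Dom A e) \<cdot> a = Ide A (Dom A e)"
  proof (rule equalizer_mono[OF e])
    have "e \<cdot> (counit T (Dom A e) \<cdot> a) = counit T X \<cdot> (ar (Fun T) e \<cdot> a)"
      using a e'(1,2) f'(4) by simp
    also have "\<dots> = e"
      unfolding ea using f' e'(1,2) by (simp add: rewrite_head[OF c_counit])
    finally show "e \<cdot> (counit T (Dom A e) \<cdot> a) = e \<cdot> Ide A (Dom A e)"
      using e'(1) by simp
  qed (use a e'(1,2) in simp_all)
  ultimately have a_coalg: "is_coalg A T (Dom A e, a)"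
    using a e'(1) by (simp add: is_coalg_iff)
  then have e_mor: "is_coalg_mor A T ((Dom A e, a), e, p)"
    using f e'(1,2) ea by (simp add: is_coalg_mor_iff)
  have "is_equalizer (coalg_cat A T) (p, f, q) (p, g, q) ((Dom A e, a), e, p)"
  proof (rule coalg.equalizerI)
    fix \<phi> assume \<phi>: "\<phi> \<in> Arr (coalg_cat A T)" "Cod (coalg_cat A T) \<phi> = Dom (coalg_cat A T) (p, f, q)"
      "(p, f, q) \<cdot>\<^bsub>coalg_cat A T\<^esub> \<phi> = (p, g, q) \<cdot>\<^bsub>coalg_cat A T\<^esub> \<phi>"
    obtain Z z h where [simp]: "\<phi> = ((Z, z), h, p)"
      using \<phi>(2) by (cases \<phi>) auto
    have h: "is_coalg A T (Z, z)" "h \<in> Arr A" "Dom A h = Z" "Cod A h = X"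
        "z \<in> Arr A" "Dom A z = Z" "Cod A z = ob (Fun T) Z" "f \<cdot> h = g \<cdot> h"
      and hz: "c \<cdot> h = ar (Fun T) h \<cdot> z"
      using \<phi>(1,3) by (simp_all add: is_coalg_mor_iff is_coalg_iff)
    obtain k where k: "k \<in> Arr A" "Dom A k = Z" "Cod A k = Dom A e" "e \<cdot> k = h"
      using equalizer_factor[OF e, of h] h f' by auto
    have "a \<cdot> k = ar (Fun T) k \<cdot> z"
    proof (rule equalizer_mono[OF Te])
      have "ar (Fun T) e \<cdot> (ar (Fun T) k \<cdot> z) = ar (Fun T) (e \<cdot> k) \<cdot> z"
        using k(1-3) h e' by simp
      then show "ar (Fun T) e \<cdot> (a \<cdot> k) = ar (Fun T) e \<cdot> (ar (Fun T) k \<cdot> z)"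
        using k ea'[of k] hz by simp
    qed (use a e'(1,2) k h in simp_all)
    then have "is_coalg_mor A T ((Z, z), k, (Dom A e, a))"
      using k h a_coalg by (simp add: is_coalg_mor_iff)
    then show "\<exists>\<kappa>. \<kappa> \<in> Arr (coalg_cat A T) \<and>
        Dom (coalg_cat A T) \<kappa> = Dom (coalg_cat A T) \<phi> \<and>
        Cod (coalg_cat A T) \<kappa> = Dom (coalg_cat A T) ((Dom A e, a), e, p) \<and>
        ((Dom A e, a), e, p) \<cdot>\<^bsub>coalg_cat A T\<^esub> \<kappa> = \<phi>"
      using k by (intro exI[of _ "((Z, z), k, (Dom A e, a))"]) simp
  next
    fix \<phi> \<psi> assume "\<phi> \<in> Arr (coalg_cat A T)" "\<psi> \<in> Arr (coalg_cat A T)"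
      "Dom (coalg_cat A T) \<phi> = Dom (coalg_cat A T) \<psi>"
      "Cod (coalg_cat A T) \<phi> = Dom (coalg_cat A T) ((Dom A e, a), e, p)"
      "Cod (coalg_cat A T) \<psi> = Dom (coalg_cat A T) ((Dom A e, a), e, p)"
      "((Dom A e, a), e, p) \<cdot>\<^bsub>coalg_cat A T\<^esub> \<phi> = ((Dom A e, a), e, p) \<cdot>\<^bsub>coalg_cat A T\<^esub> \<psi>"
    then show "\<phi> = \<psi>"
      by (cases \<phi>; cases \<psi>) (auto simp: is_coalg_mor_iff intro: equalizer_mono[OF e])
  qed (use f g e_mor e' in simp_all)
  then show thesis by (rule that)
qed

text \<open>The second part makes an arbitrarily chosen equalizer of coalgebras as good as the one just
  constructed: the two are isomorphic, and isomorphisms of coalgebras are isomorphisms below.\<close>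

lemma coalg_coreflexive_equalizers:
  assumes ex: "has_coreflexive_equalizers A"
    and pres: "preserves_coreflexive_equalizers A A (Fun T)"
    and f: "is_coalg_mor A T (p, f, q)" and g: "is_coalg_mor A T (p, g, q)"
    and fg: "coreflexive_pair A f g"
  shows "\<exists>\<phi>. is_equalizer (coalg_cat A T) (p, f, q) (p, g, q) \<phi>"
    and "is_equalizer (coalg_cat A T) (p, f, q) (p, g, q) (r, k, p) \<Longrightarrow> is_equalizer A f g k"
proof -
  interpret coalg: category "coalg_cat A T" by (rule coalg_category)
  obtain e where e: "is_equalizer A f g e"
    using ex fg by (auto simp: has_coreflexive_equalizers_def)
  have Te: "is_equalizer A (ar (Fun T) f) (ar (Fun T) g) (ar (Fun T) e)"
    using pres fg e by (simp add: preserves_coreflexive_equalizers_def)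
  have TTe: "is_equalizer A (ar (Fun T) (ar (Fun T) f)) (ar (Fun T) (ar (Fun T) g))
      (ar (Fun T) (ar (Fun T) e))"
    using pres functor_coreflexive_pair[OF Fun_functor fg] Te
    by (simp add: preserves_coreflexive_equalizers_def)
  obtain a where a: "is_equalizer (coalg_cat A T) (p, f, q) (p, g, q) ((Dom A e, a), e, p)"
    using coalg_equalizer_of_preserved[OF f g e Te TTe] .
  then show "\<exists>\<phi>. is_equalizer (coalg_cat A T) (p, f, q) (p, g, q) \<phi>" by blast
  assume k: "is_equalizer (coalg_cat A T) (p, f, q) (p, g, q) (r, k, p)"
  obtain \<mu> where \<mu>: "is_iso (coalg_cat A T) \<mu>"
      "Dom (coalg_cat A T) \<mu> = Dom (coalg_cat A T) (r, k, p)"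
      "Cod (coalg_cat A T) \<mu> = Dom (coalg_cat A T) ((Dom A e, a), e, p)"
      "((Dom A e, a), e, p) \<cdot>\<^bsub>coalg_cat A T\<^esub> \<mu> = (r, k, p)"
    by (rule coalg.equalizers_iso[OF a k])
  obtain u where u [simp]: "\<mu> = (r, u, (Dom A e, a))" using \<mu>(2,3) by (cases \<mu>) auto
  have "is_coalg_mor A T \<mu>" using \<mu>(1) by (auto simp: is_iso_def)
  then have "is_iso A u" "Cod A u = Dom A e"
    using \<mu>(1) coalg_iso_iff[of r u "(Dom A e, a)"] by (cases r; auto simp: is_coalg_mor_iff)+
  then show "is_equalizer A f g k"
    using equalizer_Comp_iso[OF e] \<mu>(4) by auto
qed

end

section \<open>The mate, the conjugate transformation and the lifted functor\<close>

locale colax_adjunction =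
  fixes M :: "('o, 'a) cat" and N :: "('p, 'b) cat"
    and C :: "('o, 'a) comonad_data" and D :: "('p, 'b) comonad_data"
    and H :: "('o, 'a, 'p, 'b) funct" and K :: "('p, 'b, 'o, 'a) funct"
    and \<eta> :: "'o \<Rightarrow> 'a" and \<xi> :: "'p \<Rightarrow> 'b" and \<sigma> :: "'o \<Rightarrow> 'b"
  assumes adj: "adjunction M N H K \<eta> \<xi>"
    and C_comonad: "comonad M C" and D_comonad: "comonad N D"
    and colax: "colax_morphism M C N D H \<sigma>"
begin

abbreviation \<tau> where "\<tau> \<equiv> mate M C D K \<eta> \<xi> \<sigma>"
abbreviation \<sigma>' where "\<sigma>' \<equiv> conj_trans N D K \<xi> \<sigma>"

lemma H_functor: "is_functor M N H" and K_functor: "is_functor N M K"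
  using adj by (simp_all add: adjunction_def)

lemma \<sigma>_trans: "nat_trans M N (H \<circ>\<^sub>F Fun C) (Fun D \<circ>\<^sub>F H) \<sigma>"
  using colax by (simp add: colax_morphism_def)

end

sublocale colax_adjunction \<subseteq> C: comonad_on M C
  using functor_categories[OF H_functor] C_comonad
  by (simp add: comonad_on_def comonad_on_axioms_def)

sublocale colax_adjunction \<subseteq> D: comonad_on N D
  using functor_categories[OF H_functor] D_comonad
  by (simp add: comonad_on_def comonad_on_axioms_def)

context colax_adjunction
begin

lemmas [simp] = functor_simps[OF H_functor] functor_simps[OF K_functor]

lemma unit_arr [simp]:
  assumes "X \<in> Obj M"
  shows "\<eta> X \<in> Arr M" "Dom M (\<eta> X) = X" "Cod M (\<eta> X) = ob K (ob H X)"
  using adj assms by (auto simp: adjunction_def nat_trans_def Hom_def id_funct_def comp_funct_def)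

lemma counit_arr [simp]:
  assumes "Y \<in> Obj N"
  shows "\<xi> Y \<in> Arr N" "Dom N (\<xi> Y) = ob H (ob K Y)" "Cod N (\<xi> Y) = Y"
  using adj assms by (auto simp: adjunction_def nat_trans_def Hom_def id_funct_def comp_funct_def)

lemma unit_nat:
  "f \<in> Arr M \<Longrightarrow> Cod M f = X \<Longrightarrow> \<eta> X \<cdot>\<^bsub>M\<^esub> f = ar K (ar H f) \<cdot>\<^bsub>M\<^esub> \<eta> (Dom M f)"
  using adj by (auto simp: adjunction_def nat_trans_def id_funct_def comp_funct_def)

lemma counit_nat [simp]:
  "f \<in> Arr N \<Longrightarrow> Cod N f = Y \<Longrightarrow> \<xi> Y \<cdot>\<^bsub>N\<^esub> ar H (ar K f) = f \<cdot>\<^bsub>N\<^esub> \<xi> (Dom N f)"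
  using adj by (auto simp: adjunction_def nat_trans_def id_funct_def comp_funct_def)

lemma triangles [simp]:
  "X \<in> Obj M \<Longrightarrow> \<xi> (ob H X) \<cdot>\<^bsub>N\<^esub> ar H (\<eta> X) = Ide N (ob H X)"
  "Y \<in> Obj N \<Longrightarrow> ar K (\<xi> Y) \<cdot>\<^bsub>M\<^esub> \<eta> (ob K Y) = Ide M (ob K Y)"
  using adj by (auto simp: adjunction_def)

lemmas adjunction_reassoc [simp] =
  D.rewrite_head[OF counit_nat] D.rewrite_head[OF triangles(1)] C.rewrite_head[OF triangles(2)]

lemma \<sigma>_arr [simp]:
  assumes "X \<in> Obj M"
  shows "\<sigma> X \<in> Arr N" "Dom N (\<sigma> X) = ob H (ob (Fun C) X)" "Cod N (\<sigma> X) = ob (Fun D) (ob H X)"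
  using \<sigma>_trans assms by (auto simp: nat_trans_def Hom_def comp_funct_def)

lemma \<sigma>_nat [simp]:
  "f \<in> Arr M \<Longrightarrow> Cod M f = X \<Longrightarrow>
    \<sigma> X \<cdot>\<^bsub>N\<^esub> ar H (ar (Fun C) f) = ar (Fun D) (ar H f) \<cdot>\<^bsub>N\<^esub> \<sigma> (Dom M f)"
  using \<sigma>_trans by (auto simp: nat_trans_def comp_funct_def)

lemma \<sigma>_counit [simp]:
  "X \<in> Obj M \<Longrightarrow> counit D (ob H X) \<cdot>\<^bsub>N\<^esub> \<sigma> X = ar H (counit C X)"
  using colax by (simp add: colax_morphism_def)

lemma \<sigma>_comult:
  "X \<in> Obj M \<Longrightarrow> comult D (ob H X) \<cdot>\<^bsub>N\<^esub> \<sigma> X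
    = ar (Fun D) (\<sigma> X) \<cdot>\<^bsub>N\<^esub> (\<sigma> (ob (Fun C) X) \<cdot>\<^bsub>N\<^esub> ar H (comult C X))"
  using colax by (simp add: colax_morphism_def)

lemmas \<sigma>_reassoc [simp] = D.rewrite_head[OF \<sigma>_nat] D.rewrite_head[OF \<sigma>_counit]

lemma \<sigma>'_arr [simp]:
  assumes "Y \<in> Obj N"
  shows "\<sigma>' Y \<in> Arr N" "Dom N (\<sigma>' Y) = ob H (ob (Fun C) (ob K Y))"
    "Cod N (\<sigma>' Y) = ob (Fun D) Y"
  using assms by (simp_all add: conj_trans_def)

lemma \<sigma>'_nat:
  "f \<in> Arr N \<Longrightarrow> Cod N f = Y \<Longrightarrow>
    \<sigma>' Y \<cdot>\<^bsub>N\<^esub> ar H (ar (Fun C) (ar K f)) = ar (Fun D) f \<cdot>\<^bsub>N\<^esub> \<sigma>' (Dom N f)"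
  using conj_trans_nat[OF adj C_comonad D_comonad \<sigma>_trans]
  by (auto simp: nat_trans_def comp_funct_def conj_comonad_def)

lemma \<sigma>'_unit:
  "X \<in> Obj M \<Longrightarrow> \<sigma>' (ob H X) \<cdot>\<^bsub>N\<^esub> ar H (ar (Fun C) (\<eta> X)) = \<sigma> X"
  using conj_trans_factor[OF adj C_comonad D_comonad \<sigma>_trans] .

lemma \<tau>_eq: "Y \<in> Obj N \<Longrightarrow> \<tau> Y = ar K (\<sigma>' Y) \<cdot>\<^bsub>M\<^esub> \<eta> (ob (Fun C) (ob K Y))"
  by (simp add: mate_def conj_trans_def)

lemma \<tau>_arr [simp]:
  assumes "Y \<in> Obj N"
  shows "\<tau> Y \<in> Arr M" "Dom M (\<tau> Y) = ob (Fun C) (ob K Y)" "Cod M (\<tau> Y) = ob K (ob (Fun D) Y)"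
  using assms by (simp_all add: \<tau>_eq)

text \<open>The transformations \<open>\<tau>\<close> and \<open>\<sigma>'\<close> are transposes of each other under \<open>H \<rightleftharpoons> K\<close>. Each law of \<open>\<tau>\<close>
  is therefore the transpose of a law of \<open>\<sigma>'\<close>, and the latter follow from the definition of \<open>\<sigma>'\<close>
  and the colax structure.\<close>

lemma counit_\<tau> [simp]: "Y \<in> Obj N \<Longrightarrow> \<xi> (ob (Fun D) Y) \<cdot>\<^bsub>N\<^esub> ar H (\<tau> Y) = \<sigma>' Y"
  by (simp add: \<tau>_eq)

lemma \<tau>_nat:
  assumes f: "f \<in> Arr N" "Cod N f = Y"
  shows "\<tau> Y \<cdot>\<^bsub>M\<^esub> ar (Fun C) (ar K f) = ar K (ar (Fun D) f) \<cdot>\<^bsub>M\<^esub> \<tau> (Dom N f)"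
proof -
  let ?CK = "\<lambda>Z. ob (Fun C) (ob K Z)"
  have "\<tau> Y \<cdot>\<^bsub>M\<^esub> ar (Fun C) (ar K f)
      = ar K (\<sigma>' Y \<cdot>\<^bsub>N\<^esub> ar H (ar (Fun C) (ar K f))) \<cdot>\<^bsub>M\<^esub> \<eta> (?CK (Dom N f))"
    using f by (auto simp: \<tau>_eq unit_nat)
  also have "\<dots> = ar K (ar (Fun D) f) \<cdot>\<^bsub>M\<^esub> \<tau> (Dom N f)"
    unfolding \<sigma>'_nat[OF f] using f by (auto simp: \<tau>_eq)
  finally show ?thesis .
qed

lemma \<sigma>'_counit:
  "Y \<in> Obj N \<Longrightarrow> counit D Y \<cdot>\<^bsub>N\<^esub> \<sigma>' Y = \<xi> Y \<cdot>\<^bsub>N\<^esub> ar H (counit C (ob K Y))"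
  by (simp add: conj_trans_def)

text \<open>This square says that \<open>\<sigma>'\<close> turns the first of the two maps defining \<open>K\<^sup>\<tau>\<close>, after applying \<open>H\<close>,
  into the comultiplication of \<open>D\<close>; naturality does the same for the second map and \<open>D d\<close>. It reduces to the compatibility of
  \<open>\<sigma>\<close> with the comultiplications, by naturality of \<open>\<sigma>\<close> and \<open>\<xi> \<cdot> H \<tau> = \<sigma>'\<close>.\<close>

lemma \<sigma>'_comult:
  assumes Y: "Y \<in> Obj N"
  shows "\<sigma>' (ob (Fun D) Y) \<cdot>\<^bsub>N\<^esub> (ar H (ar (Fun C) (\<tau> Y)) \<cdot>\<^bsub>N\<^esub> ar H (comult C (ob K Y)))
    = comult D Y \<cdot>\<^bsub>N\<^esub> \<sigma>' Y"
proof -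
  let ?Hd = "ar H (comult C (ob K Y))" and ?s = "\<sigma> (ob (Fun C) (ob K Y))"
  have "\<sigma>' (ob (Fun D) Y) \<cdot>\<^bsub>N\<^esub> (ar H (ar (Fun C) (\<tau> Y)) \<cdot>\<^bsub>N\<^esub> ?Hd)
      = ar (Fun D) (\<xi> (ob (Fun D) Y) \<cdot>\<^bsub>N\<^esub> ar H (\<tau> Y)) \<cdot>\<^bsub>N\<^esub> (?s \<cdot>\<^bsub>N\<^esub> ?Hd)"
    unfolding conj_trans_def using Y by (simp del: counit_\<tau>)
  also have "\<dots> = ar (Fun D) (ar (Fun D) (\<xi> Y)) \<cdot>\<^bsub>N\<^esub>
      (ar (Fun D) (\<sigma> (ob K Y)) \<cdot>\<^bsub>N\<^esub> (?s \<cdot>\<^bsub>N\<^esub> ?Hd))"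
    unfolding counit_\<tau>[OF Y] unfolding conj_trans_def using Y by simp
  also have "\<dots> = comult D Y \<cdot>\<^bsub>N\<^esub> \<sigma>' Y"
    using Y by (simp add: conj_trans_def flip: \<sigma>_comult)
  finally show ?thesis .
qed

lemma \<tau>_counit: 
  assumes Y: "Y \<in> Obj N"
  shows "ar K (counit D Y) \<cdot>\<^bsub>M\<^esub> \<tau> Y = counit C (ob K Y)"
proof -
  have "ar K (counit D Y) \<cdot>\<^bsub>M\<^esub> \<tau> Y
      = ar K (counit D Y \<cdot>\<^bsub>N\<^esub> \<sigma>' Y) \<cdot>\<^bsub>M\<^esub> \<eta> (ob (Fun C) (ob K Y))"
    using Y by (simp add: \<tau>_eq)
  also have "\<dots> = ar K (\<xi> Y) \<cdot>\<^bsub>M\<^esub> (\<eta> (ob K Y) \<cdot>\<^bsub>M\<^esub> counit C (ob K Y))"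
    unfolding \<sigma>'_counit[OF Y] using Y by (simp add: unit_nat del: adjunction_reassoc)
  also have "\<dots> = counit C (ob K Y)" using Y by simp
  finally show ?thesis .
qed

lemma \<tau>_comult:
  assumes Y: "Y \<in> Obj N"
  shows "\<tau> (ob (Fun D) Y) \<cdot>\<^bsub>M\<^esub> (ar (Fun C) (\<tau> Y) \<cdot>\<^bsub>M\<^esub> comult C (ob K Y))
    = ar K (comult D Y) \<cdot>\<^bsub>M\<^esub> \<tau> Y"
proof -
  let ?g = "ar (Fun C) (\<tau> Y) \<cdot>\<^bsub>M\<^esub> comult C (ob K Y)"
  have "\<tau> (ob (Fun D) Y) \<cdot>\<^bsub>M\<^esub> ?g
      = ar K (\<sigma>' (ob (Fun D) Y)) \<cdot>\<^bsub>M\<^esub> (\<eta> (ob (Fun C) (ob K (ob (Fun D) Y))) \<cdot>\<^bsub>M\<^esub> ?g)"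
    using Y by (simp add: \<tau>_eq[of "ob (Fun D) Y"])
  also have "\<dots> = ar K (\<sigma>' (ob (Fun D) Y) \<cdot>\<^bsub>N\<^esub> ar H ?g) \<cdot>\<^bsub>M\<^esub> \<eta> (ob (Fun C) (ob K Y))"
    using Y unit_nat[of ?g] by simp
  also have "\<dots> = ar K (comult D Y \<cdot>\<^bsub>N\<^esub> \<sigma>' Y) \<cdot>\<^bsub>M\<^esub> \<eta> (ob (Fun C) (ob K Y))"
    using \<sigma>'_comult[OF Y] Y by simp
  also have "\<dots> = ar K (comult D Y) \<cdot>\<^bsub>M\<^esub> \<tau> Y"
    using Y by (simp add: \<tau>_eq)
  finally show ?thesis .
qed

text \<open>The two coalgebra laws are exactly where the two axioms of a colax morphism enter.\<close>

lemma H_coalg: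
  assumes "is_coalg M C (X, c)"
  shows "is_coalg N D (ob H X, \<sigma> X \<cdot>\<^bsub>N\<^esub> ar H c)"
proof -
  have c: "X \<in> Obj M" "c \<in> Arr M" "Dom M c = X" "Cod M c = ob (Fun C) X"
    and coassoc: "comult C X \<cdot>\<^bsub>M\<^esub> c = ar (Fun C) c \<cdot>\<^bsub>M\<^esub> c"
    and counit: "counit C X \<cdot>\<^bsub>M\<^esub> c = Ide M X"
    using assms by (simp_all add: C.is_coalg_iff)
  have "comult D (ob H X) \<cdot>\<^bsub>N\<^esub> (\<sigma> X \<cdot>\<^bsub>N\<^esub> ar H c)
      = ar (Fun D) (\<sigma> X) \<cdot>\<^bsub>N\<^esub> (\<sigma> (ob (Fun C) X) \<cdot>\<^bsub>N\<^esub> ar H (comult C X \<cdot>\<^bsub>M\<^esub> c))"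
    using c D.rewrite_head[OF \<sigma>_comult, of X "ar H c"] by simp
  also have "\<dots> = ar (Fun D) (\<sigma> X \<cdot>\<^bsub>N\<^esub> ar H c) \<cdot>\<^bsub>N\<^esub> (\<sigma> X \<cdot>\<^bsub>N\<^esub> ar H c)"
    unfolding coassoc using c by simp
  finally have comult: "comult D (ob H X) \<cdot>\<^bsub>N\<^esub> (\<sigma> X \<cdot>\<^bsub>N\<^esub> ar H c)
      = ar (Fun D) (\<sigma> X \<cdot>\<^bsub>N\<^esub> ar H c) \<cdot>\<^bsub>N\<^esub> (\<sigma> X \<cdot>\<^bsub>N\<^esub> ar H c)" .
  have "counit D (ob H X) \<cdot>\<^bsub>N\<^esub> (\<sigma> X \<cdot>\<^bsub>N\<^esub> ar H c) = ar H (counit C X \<cdot>\<^bsub>M\<^esub> c)"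
    using c by simp
  then show ?thesis
    using c comult unfolding counit D.is_coalg_iff by simp
qed

lemma H_coalg_mor:
  assumes "is_coalg_mor M C (p, f, q)"
  shows "is_coalg_mor N D (H_ob N H \<sigma> p, ar H f, H_ob N H \<sigma> q)"
proof (cases p; cases q)
  fix X c Y d assume [simp]: "p = (X, c)" "q = (Y, d)"
  have p: "is_coalg M C (X, c)" and q: "is_coalg M C (Y, d)"
    and f: "f \<in> Arr M" "Dom M f = X" "Cod M f = Y"
    and df: "d \<cdot>\<^bsub>M\<^esub> f = ar (Fun C) f \<cdot>\<^bsub>M\<^esub> c"
    using assms by (simp_all add: C.is_coalg_mor_iff)
  have cd: "X \<in> Obj M" "c \<in> Arr M" "Dom M c = X" "Cod M c = ob (Fun C) X"
    "Y \<in> Obj M" "d \<in> Arr M" "Dom M d = Y" "Cod M d = ob (Fun C) Y"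
    using p q by (simp_all add: C.is_coalg_iff)
  have "(\<sigma> Y \<cdot>\<^bsub>N\<^esub> ar H d) \<cdot>\<^bsub>N\<^esub> ar H f = \<sigma> Y \<cdot>\<^bsub>N\<^esub> ar H (d \<cdot>\<^bsub>M\<^esub> f)"
    using cd f by simp
  also have "\<dots> = ar (Fun D) (ar H f) \<cdot>\<^bsub>N\<^esub> (\<sigma> X \<cdot>\<^bsub>N\<^esub> ar H c)"
    unfolding df using cd f by simp
  finally show ?thesis
    using H_coalg[OF p] H_coalg[OF q] f by (simp add: H_ob_def D.is_coalg_mor_iff)
qed

lemma H_funct_functor: "is_functor (coalg_cat M C) (coalg_cat N D) (H_funct N H \<sigma>)"
  unfolding is_functor_def
proof (intro conjI ballI impI C.coalg_category D.coalg_category)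
  fix p assume "p \<in> Obj (coalg_cat M C)"
  then show "ob (H_funct N H \<sigma>) p \<in> Obj (coalg_cat N D)"
    using H_coalg by (cases p) (simp add: H_funct_def H_ob_def)
next
  fix \<phi> assume "\<phi> \<in> Arr (coalg_cat M C)"
  then show "ar (H_funct N H \<sigma>) \<phi> \<in> Hom (coalg_cat N D)
      (ob (H_funct N H \<sigma>) (Dom (coalg_cat M C) \<phi>)) (ob (H_funct N H \<sigma>) (Cod (coalg_cat M C) \<phi>))"
    using H_coalg_mor by (cases \<phi>) (simp add: H_funct_def Hom_def)
next
  fix p assume "p \<in> Obj (coalg_cat M C)"
  then show "ar (H_funct N H \<sigma>) (Ide (coalg_cat M C) p)
      = Ide (coalg_cat N D) (ob (H_funct N H \<sigma>) p)"
    by (cases p) (simp add: H_funct_def H_ob_def C.is_coalg_iff)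
next
  fix \<phi> \<psi> assume "\<phi> \<in> Arr (coalg_cat M C)" "\<psi> \<in> Arr (coalg_cat M C)"
    "Cod (coalg_cat M C) \<phi> = Dom (coalg_cat M C) \<psi>"
  then show "ar (H_funct N H \<sigma>) (\<psi> \<cdot>\<^bsub>coalg_cat M C\<^esub> \<phi>)
      = ar (H_funct N H \<sigma>) \<psi> \<cdot>\<^bsub>coalg_cat N D\<^esub> ar (H_funct N H \<sigma>) \<phi>"
    by (cases \<phi>; cases \<psi>) (auto simp: H_funct_def C.is_coalg_mor_iff)
qed

end

section \<open>The lifted right adjoint\<close>

locale colax_adjunction_equalizers = colax_adjunction +
  assumes equalizers: "has_coreflexive_equalizers M"
    and C_preserves: "preserves_coreflexive_equalizers M M (Fun C)"
begin

abbreviation can_mor where "can_mor \<equiv> K_can M C D K \<tau>"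
abbreviation K\<tau> where "K\<tau> \<equiv> K_ob M C D K \<tau>"
abbreviation can where "can q \<equiv> fst (snd (can_mor q))"
text \<open>The first of the two maps defining \<open>K\<^sup>\<tau>(Y, d)\<close>.\<close>

abbreviation left where "left Y \<equiv> ar (Fun C) (\<tau> Y) \<cdot>\<^bsub>M\<^esub> comult C (ob K Y)"
text \<open>The map of \<open>N\<close> underlying the counit of the lifted adjunction.\<close>

abbreviation cnt where "cnt q \<equiv> \<xi> (fst q) \<cdot>\<^bsub>N\<^esub> (ar H (counit C (ob K (fst q))) \<cdot>\<^bsub>N\<^esub> ar H (can q))"

lemma left_mor:
  assumes Y: "Y \<in> Obj N"
  shows "is_coalg_mor M C (cofree C (ob K Y), left Y, cofree C (ob K (ob (Fun D) Y)))"
  using C.coextension_mor[of "ob (Fun C) (ob K Y)" "comult C (ob K Y)" "\<tau> Y"]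
    C.cofree_coalg[of "ob K Y"] Y
  by (simp add: cofree_def)

lemma right_mor:
  assumes d: "d \<in> Arr N" "Dom N d = Y" "Cod N d = Z"
  shows "is_coalg_mor M C (cofree C (ob K Y), ar (Fun C) (ar K d), cofree C (ob K Z))"
  using C.cofree_mor[of "ar K d"] d by simp

text \<open>Both maps defining \<open>K\<^sup>\<tau>(Y, d)\<close> are split by \<open>C (K \<epsilon>)\<close>: this one because \<open>K \<epsilon> \<cdot> \<tau> = \<epsilon>\<close>, the other one,
  in \<open>pair_coreflexive\<close>, because of the counit law of \<open>d\<close>.\<close>

lemma left_retraction:
  assumes Y: "Y \<in> Obj N"
  shows "ar (Fun C) (ar K (counit D Y)) \<cdot>\<^bsub>M\<^esub> left Y = Ide M (ob (Fun C) (ob K Y))"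
proof -
  have "ar (Fun C) (ar K (counit D Y)) \<cdot>\<^bsub>M\<^esub> left Y
      = ar (Fun C) (ar K (counit D Y) \<cdot>\<^bsub>M\<^esub> \<tau> Y) \<cdot>\<^bsub>M\<^esub> comult C (ob K Y)"
    using Y by simp
  then show ?thesis unfolding \<tau>_counit[OF Y] using Y by simp
qed

lemma pair_coreflexive:
  assumes "is_coalg N D (Y, d)"
  shows "coreflexive_pair M (left Y) (ar (Fun C) (ar K d))"
proof -
  have d: "Y \<in> Obj N" "d \<in> Arr N" "Dom N d = Y" "Cod N d = ob (Fun D) Y"
    "counit D Y \<cdot>\<^bsub>N\<^esub> d = Ide N Y"
    using assms by (simp_all add: D.is_coalg_iff)
  have "ar (Fun C) (ar K (counit D Y)) \<cdot>\<^bsub>M\<^esub> ar (Fun C) (ar K d)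
      = ar (Fun C) (ar K (counit D Y \<cdot>\<^bsub>N\<^esub> d))"
    using d(1-4) by simp
  also have "\<dots> = Ide M (ob (Fun C) (ob K Y))" unfolding d(5) using d(1) by simp
  finally show ?thesis
    unfolding coreflexive_pair_def
    by (intro conjI bexI[of _ "ar (Fun C) (ar K (counit D Y))"])
      (use d(1-4) left_retraction[OF d(1)] in \<open>simp_all add: Hom_def\<close>)
qed

text \<open>The chosen equalizer of coalgebras is the equalizer of the underlying pair in \<open>M\<close>. All later
  arguments take place in \<open>M\<close> and \<open>N\<close> and use only this and that the equalizer is a coalgebra
  morphism.\<close>

lemma K_can_equalizer:
  assumes Yd: "is_coalg N D (Y, d)"
  shows "is_equalizer (coalg_cat M C) (K_left M C D K \<tau> (Y, d)) (K_right C D K (Y, d)) (can_mor (Y, d))"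
    and "can_mor (Y, d) = (K\<tau> (Y, d), can (Y, d), cofree C (ob K Y))"
    and "is_equalizer M (left Y) (ar (Fun C) (ar K d)) (can (Y, d))"
    and "is_coalg_mor M C (K\<tau> (Y, d), can (Y, d), cofree C (ob K Y))"
proof -
  interpret coalg: category "coalg_cat M C" by (rule C.coalg_category)
  have d: "Y \<in> Obj N" "d \<in> Arr N" "Dom N d = Y" "Cod N d = ob (Fun D) Y"
    using Yd by (simp_all add: D.is_coalg_iff)
  note creation = C.coalg_coreflexive_equalizers[OF equalizers C_preserves
      left_mor[OF d(1)] right_mor[OF d(2-4)] pair_coreflexive[OF Yd]]
  show eq: "is_equalizer (coalg_cat M C) (K_left M C D K \<tau> (Y, d)) (K_right C D K (Y, d)) (can_mor (Y, d))"
    unfolding K_can_def by (rule someI_ex) (use creation(1) in \<open>simp only: K_left_def K_right_def prod.case\<close>)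
  note E = coalg.equalizer_arrs[OF eq]
  show triple: "can_mor (Y, d) = (K\<tau> (Y, d), can (Y, d), cofree C (ob K Y))"
    using E(6) by (cases "can_mor (Y, d)") (simp add: K_ob_def K_left_def)
  show "is_coalg_mor M C (K\<tau> (Y, d), can (Y, d), cofree C (ob K Y))"
    using E(5) triple by simp
  show "is_equalizer M (left Y) (ar (Fun C) (ar K d)) (can (Y, d))"
    by (rule creation(2)[of "K\<tau> (Y, d)"]) (use eq in \<open>simp add: K_left_def K_right_def flip: triple\<close>)
qed

lemma can_arr:
  assumes Yd: "is_coalg N D (Y, d)"
  shows "can (Y, d) \<in> Arr M" "Dom M (can (Y, d)) = fst (K\<tau> (Y, d))"
    "Cod M (can (Y, d)) = ob (Fun C) (ob K Y)"
  using K_can_equalizer(4)[OF Yd] by (cases "K\<tau> (Y, d)"; simp add: C.is_coalg_mor_iff cofree_def)+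

lemma can_equalizes:
  assumes Yd: "is_coalg N D (Y, d)"
  shows "ar (Fun C) (ar K d) \<cdot>\<^bsub>M\<^esub> can (Y, d)
    = ar (Fun C) (\<tau> Y) \<cdot>\<^bsub>M\<^esub> (comult C (ob K Y) \<cdot>\<^bsub>M\<^esub> can (Y, d))"
  using C.equalizer_arrs(7)[OF K_can_equalizer(3)[OF Yd]] Yd can_arr[OF Yd]
  by (simp add: D.is_coalg_iff)

text \<open>The values of \<open>K\<^sup>\<tau>\<close> on morphisms and of the unit are definite descriptions of the same shape;
  this lemma evaluates both.\<close>

lemma induced_mor:
  assumes Yd: "is_coalg N D (Y, d)" and g: "is_coalg_mor M C (r, g, cofree C (ob K Y))"
    and eq: "left Y \<cdot>\<^bsub>M\<^esub> g = ar (Fun C) (ar K d) \<cdot>\<^bsub>M\<^esub> g"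
  obtains k where "(THE \<phi>. \<phi> \<in> Hom (coalg_cat M C) r (K\<tau> (Y, d)) \<and>
      can_mor (Y, d) \<cdot>\<^bsub>coalg_cat M C\<^esub> \<phi> = (r, g, cofree C (ob K Y))) = (r, k, K\<tau> (Y, d))"
    "is_coalg_mor M C (r, k, K\<tau> (Y, d))" "can (Y, d) \<cdot>\<^bsub>M\<^esub> k = g"
proof -
  note K = K_can_equalizer[OF Yd]
  let ?P = "\<lambda>\<phi>. \<phi> \<in> Hom (coalg_cat M C) r (K\<tau> (Y, d)) \<and>
      can_mor (Y, d) \<cdot>\<^bsub>coalg_cat M C\<^esub> \<phi> = (r, g, cofree C (ob K Y))"
  have dom: "Dom (coalg_cat M C) (can_mor (Y, d)) = K\<tau> (Y, d)" by (simp add: K_ob_def)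
  have "\<exists>!\<phi>. \<phi> \<in> Hom (coalg_cat M C) (Dom (coalg_cat M C) \<psi>) (K\<tau> (Y, d)) \<and>
      can_mor (Y, d) \<cdot>\<^bsub>coalg_cat M C\<^esub> \<phi> = \<psi>"
    if "\<psi> \<in> Arr (coalg_cat M C)" "Cod (coalg_cat M C) \<psi> = Dom (coalg_cat M C) (K_left M C D K \<tau> (Y, d))"
      "K_left M C D K \<tau> (Y, d) \<cdot>\<^bsub>coalg_cat M C\<^esub> \<psi> = K_right C D K (Y, d) \<cdot>\<^bsub>coalg_cat M C\<^esub> \<psi>" for \<psi>
    using K(1) that unfolding is_equalizer_def dom by blast
  from this[of "(r, g, cofree C (ob K Y))"] have "\<exists>!\<phi>. ?P \<phi>"
    using g eq by (simp add: K_left_def K_right_def)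
  then have P: "?P (THE \<phi>. ?P \<phi>)" by (rule theI')
  then obtain k where k: "(THE \<phi>. ?P \<phi>) = (r, k, K\<tau> (Y, d))"
    by (cases "THE \<phi>. ?P \<phi>") (auto simp: Hom_def)
  have "is_coalg_mor M C (r, k, K\<tau> (Y, d))"
    using P unfolding k by (simp add: Hom_def)
  moreover have "can (Y, d) \<cdot>\<^bsub>M\<^esub> k = g"
    using P unfolding k by (subst (asm) K(2)) simp
  ultimately show thesis using that k by blast
qed

lemma K_funct_mor:
  assumes f: "is_coalg_mor N D ((Y, d), f, (Z, b))"
  obtains k where "ar (K_funct M C D K \<tau>) ((Y, d), f, (Z, b)) = (K\<tau> (Y, d), k, K\<tau> (Z, b))"
    "is_coalg_mor M C (K\<tau> (Y, d), k, K\<tau> (Z, b))"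
    "can (Z, b) \<cdot>\<^bsub>M\<^esub> k = ar (Fun C) (ar K f) \<cdot>\<^bsub>M\<^esub> can (Y, d)"
proof -
  have Yd: "is_coalg N D (Y, d)" and Zb: "is_coalg N D (Z, b)"
    and f': "f \<in> Arr N" "Dom N f = Y" "Cod N f = Z"
    and bf: "b \<cdot>\<^bsub>N\<^esub> f = ar (Fun D) f \<cdot>\<^bsub>N\<^esub> d"
    using f by (simp_all add: D.is_coalg_mor_iff)
  have d: "Y \<in> Obj N" "d \<in> Arr N" "Dom N d = Y" "Cod N d = ob (Fun D) Y"
    and b: "Z \<in> Obj N" "b \<in> Arr N" "Dom N b = Z" "Cod N b = ob (Fun D) Z"
    using Yd Zb by (simp_all add: D.is_coalg_iff)
  note can [simp] = can_arr[OF Yd]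
  let ?g = "ar (Fun C) (ar K f) \<cdot>\<^bsub>M\<^esub> can (Y, d)"
  have g: "is_coalg_mor M C (K\<tau> (Y, d), ?g, cofree C (ob K Z))"
    by (rule C.coalg_mor_Comp[OF K_can_equalizer(4)[OF Yd] right_mor[OF f']])
  have comp: "(cofree C (ob K Y), ar (Fun C) (ar K f), cofree C (ob K Z)) \<cdot>\<^bsub>coalg_cat M C\<^esub> can_mor (Y, d)
      = (K\<tau> (Y, d), ?g, cofree C (ob K Z))"
    by (subst K_can_equalizer(2)[OF Yd]) simp
  have "left Z \<cdot>\<^bsub>M\<^esub> ?g
      = ar (Fun C) (\<tau> Z \<cdot>\<^bsub>M\<^esub> ar (Fun C) (ar K f)) \<cdot>\<^bsub>M\<^esub> (comult C (ob K Y) \<cdot>\<^bsub>M\<^esub> can (Y, d))"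
    using f' d b by simp
  also have "\<dots> = ar (Fun C) (ar K (ar (Fun D) f)) \<cdot>\<^bsub>M\<^esub> (ar (Fun C) (ar K d) \<cdot>\<^bsub>M\<^esub> can (Y, d))"
    unfolding \<tau>_nat[OF f'(1,3)] can_equalizes[OF Yd] using f' d by simp
  also have "\<dots> = ar (Fun C) (ar K (ar (Fun D) f \<cdot>\<^bsub>N\<^esub> d)) \<cdot>\<^bsub>M\<^esub> can (Y, d)"
    using f' d by simp
  also have "\<dots> = ar (Fun C) (ar K b) \<cdot>\<^bsub>M\<^esub> ?g"
    unfolding bf[symmetric] using f' d b by simp
  finally have "left Z \<cdot>\<^bsub>M\<^esub> ?g = ar (Fun C) (ar K b) \<cdot>\<^bsub>M\<^esub> ?g" .
  then show thesis
    by (rule induced_mor[OF Zb g]) (rule that, simp_all add: K_funct_def comp)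
qed

text \<open>The map \<open>C \<eta> \<cdot> c\<close> equalizes the pair of \<open>H\<^sub>\<sigma>(X, c)\<close> because \<open>\<tau> \<cdot> C \<eta> = K \<sigma> \<cdot> \<eta>\<close>, the transpose of
  the universal property \<open>\<sigma>' \<cdot> H C \<eta> = \<sigma>\<close>.\<close>

lemma unit_mor:
  assumes Xc: "is_coalg M C (X, c)"
  obtains k where "HK_unit M C N D H K \<eta> \<sigma> \<tau> (X, c) = ((X, c), k, K\<tau> (H_ob N H \<sigma> (X, c)))"
    "is_coalg_mor M C ((X, c), k, K\<tau> (H_ob N H \<sigma> (X, c)))"
    "can (H_ob N H \<sigma> (X, c)) \<cdot>\<^bsub>M\<^esub> k = ar (Fun C) (\<eta> X) \<cdot>\<^bsub>M\<^esub> c"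
proof -
  have c: "X \<in> Obj M" "c \<in> Arr M" "Dom M c = X" "Cod M c = ob (Fun C) X"
    and coassoc: "comult C X \<cdot>\<^bsub>M\<^esub> c = ar (Fun C) c \<cdot>\<^bsub>M\<^esub> c"
    using Xc by (simp_all add: C.is_coalg_iff)
  let ?d = "\<sigma> X \<cdot>\<^bsub>N\<^esub> ar H c" and ?g = "ar (Fun C) (\<eta> X) \<cdot>\<^bsub>M\<^esub> c"
  have g: "is_coalg_mor M C ((X, c), ?g, cofree C (ob K (ob H X)))"
    using C.coextension_mor[OF Xc, of "\<eta> X"] c by simp
  have \<tau>\<eta>: "\<tau> (ob H X) \<cdot>\<^bsub>M\<^esub> ar (Fun C) (\<eta> X) = ar K (\<sigma> X) \<cdot>\<^bsub>M\<^esub> \<eta> (ob (Fun C) X)"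
  proof -
    have "\<tau> (ob H X) \<cdot>\<^bsub>M\<^esub> ar (Fun C) (\<eta> X)
        = ar K (\<sigma>' (ob H X) \<cdot>\<^bsub>N\<^esub> ar H (ar (Fun C) (\<eta> X))) \<cdot>\<^bsub>M\<^esub> \<eta> (ob (Fun C) X)"
      using c by (simp add: \<tau>_eq unit_nat)
    then show ?thesis unfolding \<sigma>'_unit[OF c(1)] .
  qed
  have "left (ob H X) \<cdot>\<^bsub>M\<^esub> ?g
      = ar (Fun C) (\<tau> (ob H X) \<cdot>\<^bsub>M\<^esub> ar (Fun C) (\<eta> X)) \<cdot>\<^bsub>M\<^esub> (comult C X \<cdot>\<^bsub>M\<^esub> c)"
    using c by simp
  also have "\<dots> = ar (Fun C) (ar K (\<sigma> X) \<cdot>\<^bsub>M\<^esub> (\<eta> (ob (Fun C) X) \<cdot>\<^bsub>M\<^esub> c)) \<cdot>\<^bsub>M\<^esub> c"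
    unfolding \<tau>\<eta> coassoc using c by simp
  also have "\<dots> = ar (Fun C) (ar K ?d) \<cdot>\<^bsub>M\<^esub> ?g"
    using c by (simp add: unit_nat)
  finally have "left (ob H X) \<cdot>\<^bsub>M\<^esub> ?g = ar (Fun C) (ar K ?d) \<cdot>\<^bsub>M\<^esub> ?g" .
  then show thesis
    by (rule induced_mor[OF H_coalg[OF Xc] g]) (rule that, simp_all add: HK_unit_def H_ob_def)
qed

lemma cnt_arr:
  assumes Yd: "is_coalg N D (Y, d)"
  shows "cnt (Y, d) \<in> Arr N" "Dom N (cnt (Y, d)) = ob H (fst (K\<tau> (Y, d)))"
    "Cod N (cnt (Y, d)) = Y"
  using Yd can_arr[OF Yd] by (simp_all add: D.is_coalg_iff)

lemma HK_counit_eq: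
  assumes Yd: "is_coalg N D (Y, d)"
  shows "HK_counit M C N D H K \<xi> \<sigma> \<tau> (Y, d) = (H_ob N H \<sigma> (K\<tau> (Y, d)), cnt (Y, d), (Y, d))"
proof -
  have "Y \<in> Obj N" using Yd by (simp add: D.is_coalg_iff)
  then have "\<xi> Y \<cdot>\<^bsub>N\<^esub> ar H (counit C (ob K Y)) \<cdot>\<^bsub>N\<^esub> ar H (can (Y, d)) = cnt (Y, d)"
    using can_arr[OF Yd] by simp
  then show ?thesis
    by (cases "can_mor (Y, d)") (simp add: HK_counit_def K_ob_def)
qed

text \<open>The counit component is \<open>\<epsilon> \<sigma>' H(e)\<close>. Naturality moves \<open>d\<close> to the right of \<open>\<sigma>'\<close>, where \<open>e\<close>
  equalizes it with the map corresponding to \<open>\<delta>\<close>; then \<open>\<epsilon>\<close> cancels \<open>\<delta>\<close>.\<close>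

lemma coaction_cnt:
  assumes Yd: "is_coalg N D (Y, d)"
  shows "d \<cdot>\<^bsub>N\<^esub> cnt (Y, d) = \<sigma>' Y \<cdot>\<^bsub>N\<^esub> ar H (can (Y, d))"
proof -
  have d: "Y \<in> Obj N" "d \<in> Arr N" "Dom N d = Y" "Cod N d = ob (Fun D) Y"
    using Yd by (simp_all add: D.is_coalg_iff)
  note can [simp] = can_arr[OF Yd]
  let ?e = "ar H (can (Y, d))"
  have "d \<cdot>\<^bsub>N\<^esub> cnt (Y, d) = d \<cdot>\<^bsub>N\<^esub> (counit D Y \<cdot>\<^bsub>N\<^esub> (\<sigma>' Y \<cdot>\<^bsub>N\<^esub> ?e))"
    using d D.rewrite_head[OF \<sigma>'_counit, of Y ?e] by simp
  also have "\<dots> = counit D (ob (Fun D) Y) \<cdot>\<^bsub>N\<^esub> ((ar (Fun D) d \<cdot>\<^bsub>N\<^esub> \<sigma>' Y) \<cdot>\<^bsub>N\<^esub> ?e)"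
    using d by simp
  also have "\<dots> = counit D (ob (Fun D) Y) \<cdot>\<^bsub>N\<^esub>
      (\<sigma>' (ob (Fun D) Y) \<cdot>\<^bsub>N\<^esub> ar H (ar (Fun C) (ar K d) \<cdot>\<^bsub>M\<^esub> can (Y, d)))"
    using D.rewrite_head[OF \<sigma>'_nat[OF d(2,4)], of ?e] d by simp
  also have "\<dots> = counit D (ob (Fun D) Y) \<cdot>\<^bsub>N\<^esub> (comult D Y \<cdot>\<^bsub>N\<^esub> (\<sigma>' Y \<cdot>\<^bsub>N\<^esub> ?e))"
    unfolding can_equalizes[OF Yd]
    using d D.rewrite_head[OF \<sigma>'_comult, of Y ?e] by simp
  also have "\<dots> = \<sigma>' Y \<cdot>\<^bsub>N\<^esub> ?e" using d by simp
  finally show ?thesis .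
qed

lemma counit_mor:
  assumes Yd: "is_coalg N D (Y, d)"
  shows "is_coalg_mor N D (H_ob N H \<sigma> (K\<tau> (Y, d)), cnt (Y, d), (Y, d))"
proof -
  obtain E a where Ea: "K\<tau> (Y, d) = (E, a)" by fastforce
  have d: "Y \<in> Obj N" "d \<in> Arr N" "Dom N d = Y" "Cod N d = ob (Fun D) Y"
    using Yd by (simp_all add: D.is_coalg_iff)
  note can [simp] = can_arr[OF Yd, unfolded Ea fst_conv]
  have a: "is_coalg M C (E, a)" "E \<in> Obj M" "a \<in> Arr M" "Dom M a = E" "Cod M a = ob (Fun C) E"
    and can_a: "comult C (ob K Y) \<cdot>\<^bsub>M\<^esub> can (Y, d) = ar (Fun C) (can (Y, d)) \<cdot>\<^bsub>M\<^esub> a"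
    using K_can_equalizer(4)[OF Yd] unfolding Ea
    by (simp_all add: C.is_coalg_mor_iff C.is_coalg_iff cofree_def)
  have "ar (Fun D) (cnt (Y, d)) \<cdot>\<^bsub>N\<^esub> (\<sigma> E \<cdot>\<^bsub>N\<^esub> ar H a)
      = \<sigma>' Y \<cdot>\<^bsub>N\<^esub> (ar H (ar (Fun C) (counit C (ob K Y)) \<cdot>\<^bsub>M\<^esub>
          (ar (Fun C) (can (Y, d)) \<cdot>\<^bsub>M\<^esub> a)))"
    using d a by (simp add: conj_trans_def)
  also have "\<dots> = \<sigma>' Y \<cdot>\<^bsub>N\<^esub> ar H (can (Y, d))"
    unfolding can_a[symmetric] using d by simp
  finally have "d \<cdot>\<^bsub>N\<^esub> cnt (Y, d) = ar (Fun D) (cnt (Y, d)) \<cdot>\<^bsub>N\<^esub> (\<sigma> E \<cdot>\<^bsub>N\<^esub> ar H a)"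
    using coaction_cnt[OF Yd] by simp
  then show ?thesis
    using Yd H_coalg[OF a(1)] cnt_arr[OF Yd] unfolding Ea
    by (simp add: H_ob_def D.is_coalg_mor_iff)
qed

lemma cnt_nat:
  assumes f: "is_coalg_mor N D ((Y, d), f, (Z, b))"
    and k: "is_coalg_mor M C (K\<tau> (Y, d), k, K\<tau> (Z, b))"
      "can (Z, b) \<cdot>\<^bsub>M\<^esub> k = ar (Fun C) (ar K f) \<cdot>\<^bsub>M\<^esub> can (Y, d)"
  shows "cnt (Z, b) \<cdot>\<^bsub>N\<^esub> ar H k = f \<cdot>\<^bsub>N\<^esub> cnt (Y, d)"
proof -
  have Yd: "is_coalg N D (Y, d)" and Zb: "is_coalg N D (Z, b)"
    and f': "f \<in> Arr N" "Dom N f = Y" "Cod N f = Z" "Y \<in> Obj N" "Z \<in> Obj N"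
    using f by (simp_all add: D.is_coalg_mor_iff D.is_coalg_iff)
  have k': "k \<in> Arr M" "Dom M k = fst (K\<tau> (Y, d))" "Cod M k = fst (K\<tau> (Z, b))"
    using k(1) by (cases "K\<tau> (Y, d)"; cases "K\<tau> (Z, b)"; simp add: C.is_coalg_mor_iff)+
  note [simp] = can_arr[OF Yd] can_arr[OF Zb]
  have "cnt (Z, b) \<cdot>\<^bsub>N\<^esub> ar H k
      = \<xi> Z \<cdot>\<^bsub>N\<^esub> ar H (counit C (ob K Z) \<cdot>\<^bsub>M\<^esub> (can (Z, b) \<cdot>\<^bsub>M\<^esub> k))"
    using f' k' by simp
  also have "\<dots> = f \<cdot>\<^bsub>N\<^esub> cnt (Y, d)" unfolding k(2) using f' by simp
  finally show ?thesis .
qed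

lemma cnt_unit:
  assumes Xc: "is_coalg M C (X, c)"
    and k: "is_coalg_mor M C ((X, c), k, K\<tau> (H_ob N H \<sigma> (X, c)))"
      "can (H_ob N H \<sigma> (X, c)) \<cdot>\<^bsub>M\<^esub> k = ar (Fun C) (\<eta> X) \<cdot>\<^bsub>M\<^esub> c"
  shows "cnt (H_ob N H \<sigma> (X, c)) \<cdot>\<^bsub>N\<^esub> ar H k = Ide N (ob H X)"
proof -
  have c: "X \<in> Obj M" "c \<in> Arr M" "Dom M c = X" "Cod M c = ob (Fun C) X"
    and c_counit: "counit C X \<cdot>\<^bsub>M\<^esub> c = Ide M X"
    using Xc by (simp_all add: C.is_coalg_iff)
  let ?q = "H_ob N H \<sigma> (X, c)"
  have q: "?q = (ob H X, \<sigma> X \<cdot>\<^bsub>N\<^esub> ar H c)" by (simp add: H_ob_def)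
  have k': "k \<in> Arr M" "Dom M k = X" "Cod M k = fst (K\<tau> ?q)"
    using k(1) by (cases "K\<tau> ?q"; simp add: C.is_coalg_mor_iff)+
  note [simp] = can_arr[OF H_coalg[OF Xc], folded q]
  have "cnt ?q \<cdot>\<^bsub>N\<^esub> ar H k
      = \<xi> (ob H X) \<cdot>\<^bsub>N\<^esub> ar H (counit C (ob K (ob H X)) \<cdot>\<^bsub>M\<^esub> (can ?q \<cdot>\<^bsub>M\<^esub> k))"
    using c k' by (simp add: q[THEN arg_cong[of _ _ fst]])
  also have "\<dots> = ar H (counit C X \<cdot>\<^bsub>M\<^esub> c)" unfolding k(2) using c by simp
  finally show ?thesis unfolding c_counit using c by simp
qed

text \<open>Composing with the counit amounts to transposing \<open>\<epsilon> e g\<close>, which in turn determines the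
  coalgebra morphism \<open>e g\<close> into a cofree coalgebra; finally \<open>e\<close> is monic.\<close>

lemma cnt_inj:
  assumes Yd: "is_coalg N D (Y, d)"
    and g: "is_coalg_mor M C ((X, c), g, K\<tau> (Y, d))"
    and h: "is_coalg_mor M C ((X, c), h, K\<tau> (Y, d))"
    and eq: "cnt (Y, d) \<cdot>\<^bsub>N\<^esub> ar H g = cnt (Y, d) \<cdot>\<^bsub>N\<^esub> ar H h"
  shows "g = h"
proof -
  note can [simp] = can_arr[OF Yd]
  have Y: "Y \<in> Obj N" using Yd by (simp add: D.is_coalg_iff)
  then have KY: "ob K Y \<in> Obj M" by simp
  have gh [simp]: "g \<in> Arr M" "Dom M g = X" "Cod M g = fst (K\<tau> (Y, d))"
    "h \<in> Arr M" "Dom M h = X" "Cod M h = fst (K\<tau> (Y, d))" "X \<in> Obj M"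
    using g h by (cases "K\<tau> (Y, d)"; simp add: C.is_coalg_mor_iff C.is_coalg_iff)+
  have transpose: "counit C (ob K Y) \<cdot>\<^bsub>M\<^esub> (can (Y, d) \<cdot>\<^bsub>M\<^esub> l)
      = ar K (cnt (Y, d) \<cdot>\<^bsub>N\<^esub> ar H l) \<cdot>\<^bsub>M\<^esub> \<eta> X"
    if l: "l \<in> Arr M" "Dom M l = X" "Cod M l = fst (K\<tau> (Y, d))" for l
  proof -
    let ?m = "counit C (ob K Y) \<cdot>\<^bsub>M\<^esub> (can (Y, d) \<cdot>\<^bsub>M\<^esub> l)"
    have m: "?m \<in> Arr M" "Dom M ?m = X" "Cod M ?m = ob K Y" using l Y by simp_all
    have "ar K (cnt (Y, d) \<cdot>\<^bsub>N\<^esub> ar H l) \<cdot>\<^bsub>M\<^esub> \<eta> X = ar K (\<xi> Y) \<cdot>\<^bsub>M\<^esub> (ar K (ar H ?m) \<cdot>\<^bsub>M\<^esub> \<eta> X)"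
      using l Y by simp
    also have "\<dots> = ar K (\<xi> Y) \<cdot>\<^bsub>M\<^esub> (\<eta> (ob K Y) \<cdot>\<^bsub>M\<^esub> ?m)"
      using unit_nat[OF m(1,3)] m(2) by simp
    also have "\<dots> = ?m" using l Y by simp
    finally show ?thesis ..
  qed
  have cofree_eq: "can (Y, d) \<cdot>\<^bsub>M\<^esub> l
      = ar (Fun C) (counit C (ob K Y) \<cdot>\<^bsub>M\<^esub> (can (Y, d) \<cdot>\<^bsub>M\<^esub> l)) \<cdot>\<^bsub>M\<^esub> c"
    if "is_coalg_mor M C ((X, c), l, K\<tau> (Y, d))" for l
    by (rule C.mor_to_cofree_eq_coextension[OF C.coalg_mor_Comp[OF that K_can_equalizer(4)[OF Yd]] KY])
  have "counit C (ob K Y) \<cdot>\<^bsub>M\<^esub> (can (Y, d) \<cdot>\<^bsub>M\<^esub> g) = counit C (ob K Y) \<cdot>\<^bsub>M\<^esub> (can (Y, d) \<cdot>\<^bsub>M\<^esub> h)"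
    by (simp only: transpose gh eq)
  with cofree_eq[OF g] have "can (Y, d) \<cdot>\<^bsub>M\<^esub> g
      = ar (Fun C) (counit C (ob K Y) \<cdot>\<^bsub>M\<^esub> (can (Y, d) \<cdot>\<^bsub>M\<^esub> h)) \<cdot>\<^bsub>M\<^esub> c"
    by (rule subst[where P = "\<lambda>m. can (Y, d) \<cdot>\<^bsub>M\<^esub> g = ar (Fun C) m \<cdot>\<^bsub>M\<^esub> c", rotated])
  also have "\<dots> = can (Y, d) \<cdot>\<^bsub>M\<^esub> h"
    by (rule cofree_eq[OF h, symmetric])
  finally have "can (Y, d) \<cdot>\<^bsub>M\<^esub> g = can (Y, d) \<cdot>\<^bsub>M\<^esub> h" .
  then show ?thesis
    using C.equalizer_mono[OF K_can_equalizer(3)[OF Yd], of g h] by simp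
qed

theorem lifted_adjunction:
  "adjunction (coalg_cat M C) (coalg_cat N D) (H_funct N H \<sigma>) (K_funct M C D K \<tau>)
    (HK_unit M C N D H K \<eta> \<sigma> \<tau>) (HK_counit M C N D H K \<xi> \<sigma> \<tau>)"
proof (rule adjunction_of_couniversal_arrows[OF H_funct_functor])
  fix q assume q: "q \<in> Obj (coalg_cat N D)"
  obtain Y d where [simp]: "q = (Y, d)" by fastforce
  have Yd: "is_coalg N D (Y, d)" using q by simp
  show "ob (K_funct M C D K \<tau>) q \<in> Obj (coalg_cat M C)"
    using K_can_equalizer(4)[OF Yd]
    by (cases "K\<tau> (Y, d)") (simp add: K_funct_def cofree_def C.is_coalg_mor_iff)
  show "HK_counit M C N D H K \<xi> \<sigma> \<tau> q
      \<in> Hom (coalg_cat N D) (ob (H_funct N H \<sigma>) (ob (K_funct M C D K \<tau>) q)) q"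
    using counit_mor[OF Yd] by (simp add: HK_counit_eq[OF Yd] K_funct_def H_funct_def Hom_def)
  fix \<phi> \<psi>
  assume \<phi>\<psi>: "\<phi> \<in> Arr (coalg_cat M C)" "\<psi> \<in> Arr (coalg_cat M C)"
    "Dom (coalg_cat M C) \<phi> = Dom (coalg_cat M C) \<psi>"
    "Cod (coalg_cat M C) \<phi> = ob (K_funct M C D K \<tau>) q"
    "Cod (coalg_cat M C) \<psi> = ob (K_funct M C D K \<tau>) q"
    "HK_counit M C N D H K \<xi> \<sigma> \<tau> q \<cdot>\<^bsub>coalg_cat N D\<^esub> ar (H_funct N H \<sigma>) \<phi>
      = HK_counit M C N D H K \<xi> \<sigma> \<tau> q \<cdot>\<^bsub>coalg_cat N D\<^esub> ar (H_funct N H \<sigma>) \<psi>"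
  obtain X c g h where [simp]: "\<phi> = ((X, c), g, K\<tau> (Y, d))" "\<psi> = ((X, c), h, K\<tau> (Y, d))"
    using \<phi>\<psi>(3-5) by (cases \<phi>; cases \<psi>) (auto simp: K_funct_def)
  show "\<phi> = \<psi>"
    using \<phi>\<psi> cnt_inj[OF Yd, of X c g h] by (simp add: H_funct_def HK_counit_eq[OF Yd])
next
  fix \<phi> assume "\<phi> \<in> Arr (coalg_cat N D)"
  then obtain Y d f Z b where \<phi> [simp]: "\<phi> = ((Y, d), f, (Z, b))"
    and f: "is_coalg_mor N D ((Y, d), f, (Z, b))"
    by (cases \<phi>) auto
  have Yd: "is_coalg N D (Y, d)" and Zb: "is_coalg N D (Z, b)"
    using f by (simp_all add: D.is_coalg_mor_iff)
  obtain k where k: "ar (K_funct M C D K \<tau>) \<phi> = (K\<tau> (Y, d), k, K\<tau> (Z, b))"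
    "is_coalg_mor M C (K\<tau> (Y, d), k, K\<tau> (Z, b))"
    "can (Z, b) \<cdot>\<^bsub>M\<^esub> k = ar (Fun C) (ar K f) \<cdot>\<^bsub>M\<^esub> can (Y, d)"
    unfolding \<phi> by (rule K_funct_mor[OF f])
  show "ar (K_funct M C D K \<tau>) \<phi> \<in> Hom (coalg_cat M C)
      (ob (K_funct M C D K \<tau>) (Dom (coalg_cat N D) \<phi>)) (ob (K_funct M C D K \<tau>) (Cod (coalg_cat N D) \<phi>))"
    unfolding k(1) using k(2) by (simp add: Hom_def K_funct_def)
  show "HK_counit M C N D H K \<xi> \<sigma> \<tau> (Cod (coalg_cat N D) \<phi>) \<cdot>\<^bsub>coalg_cat N D\<^esub>
        ar (H_funct N H \<sigma>) (ar (K_funct M C D K \<tau>) \<phi>)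
      = \<phi> \<cdot>\<^bsub>coalg_cat N D\<^esub> HK_counit M C N D H K \<xi> \<sigma> \<tau> (Dom (coalg_cat N D) \<phi>)"
    unfolding k(1) using cnt_nat[OF f k(2,3)]
    by (simp add: HK_counit_eq[OF Yd] HK_counit_eq[OF Zb] H_funct_def)
next
  fix p assume "p \<in> Obj (coalg_cat M C)"
  then obtain X c where p [simp]: "p = (X, c)" and Xc: "is_coalg M C (X, c)"
    by (cases p) auto
  obtain k where k: "HK_unit M C N D H K \<eta> \<sigma> \<tau> p = ((X, c), k, K\<tau> (H_ob N H \<sigma> (X, c)))"
    "is_coalg_mor M C ((X, c), k, K\<tau> (H_ob N H \<sigma> (X, c)))"
    "can (H_ob N H \<sigma> (X, c)) \<cdot>\<^bsub>M\<^esub> k = ar (Fun C) (\<eta> X) \<cdot>\<^bsub>M\<^esub> c"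
    unfolding p by (rule unit_mor[OF Xc])
  show "HK_unit M C N D H K \<eta> \<sigma> \<tau> p
      \<in> Hom (coalg_cat M C) p (ob (K_funct M C D K \<tau>) (ob (H_funct N H \<sigma>) p))"
    unfolding k(1) using k(2) by (simp add: Hom_def H_funct_def K_funct_def)
  have "HK_counit M C N D H K \<xi> \<sigma> \<tau> (H_ob N H \<sigma> (X, c))
      = (H_ob N H \<sigma> (K\<tau> (H_ob N H \<sigma> (X, c))), cnt (H_ob N H \<sigma> (X, c)), H_ob N H \<sigma> (X, c))"
    using HK_counit_eq[OF H_coalg[OF Xc]] by (simp add: H_ob_def)
  then show "HK_counit M C N D H K \<xi> \<sigma> \<tau> (ob (H_funct N H \<sigma>) p) \<cdot>\<^bsub>coalg_cat N D\<^esub>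
        ar (H_funct N H \<sigma>) (HK_unit M C N D H K \<eta> \<sigma> \<tau> p)
      = Ide (coalg_cat N D) (ob (H_funct N H \<sigma>) p)"
    unfolding k(1) using cnt_unit[OF Xc k(2,3)] by (simp add: H_funct_def) (simp add: H_ob_def)
qed

section \<open>When the lifted adjunction is an equivalence\<close>

text \<open>At a cofree coalgebra the defining pair has a splitting by \<open>C K \<epsilon>\<close> and \<open>C K D \<epsilon>\<close>, which exhibits
  \<open>C \<tau> \<cdot> \<delta> : C K Y \<rightarrow> C K D Y\<close> as its equalizer. On this equalizer the counit is
  \<open>\<xi> H(\<epsilon> C(\<tau>) \<delta>) = \<xi> H(\<tau>) = \<sigma>'\<close>.\<close>

lemma cofree_can_iso:
  assumes Y: "Y \<in> Obj N"
  obtains u where "is_iso M u" "Cod M u = fst (K\<tau> (cofree D Y))"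
    "cnt (cofree D Y) \<cdot>\<^bsub>N\<^esub> ar H u = \<sigma>' Y"
proof -
  let ?DY = "ob (Fun D) Y"
  let ?Yd = "(?DY, comult D Y)"
  have Yd: "is_coalg N D ?Yd" using D.cofree_coalg[OF Y] by (simp add: cofree_def)
  note can [simp] = can_arr[OF Yd]
  have split: "is_equalizer M (left ?DY) (ar (Fun C) (ar K (comult D Y))) (left Y)"
  proof (rule C.split_equalizer[where s = "ar (Fun C) (ar K (counit D Y))"
        and t = "ar (Fun C) (ar K (ar (Fun D) (counit D Y)))"])
    have "left ?DY \<cdot>\<^bsub>M\<^esub> left Y
        = ar (Fun C) (\<tau> ?DY \<cdot>\<^bsub>M\<^esub> left Y) \<cdot>\<^bsub>M\<^esub> comult C (ob K Y)"
      using Y by simp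
    then show "left ?DY \<cdot>\<^bsub>M\<^esub> left Y = ar (Fun C) (ar K (comult D Y)) \<cdot>\<^bsub>M\<^esub> left Y"
      unfolding \<tau>_comult[OF Y] using Y by simp
    have "ar (Fun C) (ar K (ar (Fun D) (counit D Y))) \<cdot>\<^bsub>M\<^esub> left ?DY
        = ar (Fun C) (ar K (ar (Fun D) (counit D Y)) \<cdot>\<^bsub>M\<^esub> \<tau> ?DY) \<cdot>\<^bsub>M\<^esub> comult C (ob K ?DY)"
      using Y by simp
    also have "\<dots> = left Y \<cdot>\<^bsub>M\<^esub> ar (Fun C) (ar K (counit D Y))"
      using \<tau>_nat[of "counit D Y" Y, symmetric] Y by simp
    finally show "ar (Fun C) (ar K (ar (Fun D) (counit D Y))) \<cdot>\<^bsub>M\<^esub> left ?DY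
        = left Y \<cdot>\<^bsub>M\<^esub> ar (Fun C) (ar K (counit D Y))" .
    have "ar (Fun C) (ar K (ar (Fun D) (counit D Y))) \<cdot>\<^bsub>M\<^esub> ar (Fun C) (ar K (comult D Y))
        = ar (Fun C) (ar K (ar (Fun D) (counit D Y) \<cdot>\<^bsub>N\<^esub> comult D Y))"
      using Y by (simp del: D.comonad_laws)
    then show "ar (Fun C) (ar K (ar (Fun D) (counit D Y))) \<cdot>\<^bsub>M\<^esub> ar (Fun C) (ar K (comult D Y))
        = Ide M (Dom M (left ?DY))"
      using Y by simp
    show "ar (Fun C) (ar K (counit D Y)) \<cdot>\<^bsub>M\<^esub> left Y = Ide M (Dom M (left Y))"
      using left_retraction[OF Y] Y by simp
  qed (use Y in simp_all)
  obtain u where u: "is_iso M u" "Dom M u = Dom M (left Y)" "Cod M u = Dom M (can ?Yd)"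
      "can ?Yd \<cdot>\<^bsub>M\<^esub> u = left Y"
    by (rule C.equalizers_iso[OF K_can_equalizer(3)[OF Yd] split])
  have u_arr: "u \<in> Arr M" using u(1) by (rule C.isoE)
  have "cnt ?Yd \<cdot>\<^bsub>N\<^esub> ar H u
      = \<xi> ?DY \<cdot>\<^bsub>N\<^esub> ar H (counit C (ob K ?DY) \<cdot>\<^bsub>M\<^esub> (can ?Yd \<cdot>\<^bsub>M\<^esub> u))"
    using Y u(3) u_arr by simp
  also have "\<dots> = \<sigma>' Y" unfolding u(4) using Y by simp
  finally show thesis
    using that u(1,3) by (simp add: cofree_def)
qed

text \<open>The inverse is the factorization \<open>k\<close> of \<open>\<sigma>'\<^bsup>-1\<^esup> d\<close> through \<open>H e\<close>, which is an equalizer because \<open>H\<close>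
  preserves coreflexive ones. That it is inverse to the counit on both sides follows from
  \<open>coaction_cnt\<close>, as \<open>d\<close> is split by the counit of \<open>D\<close> and \<open>H e\<close> is monic.\<close>

lemma cnt_iso:
  assumes H_preserves: "preserves_coreflexive_equalizers M N H"
    and iso: "\<And>Y. Y \<in> Obj N \<Longrightarrow> is_iso N (\<sigma>' Y)" and Yd: "is_coalg N D (Y, d)"
  shows "is_iso N (cnt (Y, d))"
proof -
  have d: "Y \<in> Obj N" "d \<in> Arr N" "Dom N d = Y" "Cod N d = ob (Fun D) Y"
    and coassoc: "comult D Y \<cdot>\<^bsub>N\<^esub> d = ar (Fun D) d \<cdot>\<^bsub>N\<^esub> d"
    and d_counit: "counit D Y \<cdot>\<^bsub>N\<^esub> d = Ide N Y"
    using Yd by (simp_all add: D.is_coalg_iff)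
  let ?DY = "ob (Fun D) Y" and ?HCKd = "ar H (ar (Fun C) (ar K d))" and ?e = "ar H (can (Y, d))"
  note can [simp] = can_arr[OF Yd]
  note cnt = cnt_arr[OF Yd]
  have e: "is_equalizer N (ar H (left Y)) ?HCKd ?e"
    using H_preserves pair_coreflexive[OF Yd] K_can_equalizer(3)[OF Yd]
    by (simp add: preserves_coreflexive_equalizers_def)
  have E: "fst (K\<tau> (Y, d)) \<in> Obj M"
    using C.Dom_in[OF can(1)] can(2) by simp
  obtain t where t: "t \<in> Arr N" "Dom N t = ?DY" "Cod N t = ob H (ob (Fun C) (ob K Y))"
      "t \<cdot>\<^bsub>N\<^esub> \<sigma>' Y = Ide N (ob H (ob (Fun C) (ob K Y)))" "\<sigma>' Y \<cdot>\<^bsub>N\<^esub> t = Ide N ?DY"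
    using D.isoE[OF iso[OF d(1)]] unfolding \<sigma>'_arr[OF d(1)] .
  have DY: "?DY \<in> Obj N" using d(1) by simp
  obtain t' where t': "t' \<in> Arr N" "Dom N t' = ob (Fun D) ?DY"
      "Cod N t' = ob H (ob (Fun C) (ob K ?DY))"
      "t' \<cdot>\<^bsub>N\<^esub> \<sigma>' ?DY = Ide N (ob H (ob (Fun C) (ob K ?DY)))"
    using D.isoE[OF iso[OF DY]] unfolding \<sigma>'_arr[OF DY] .
  have st: "\<sigma>' Y \<cdot>\<^bsub>N\<^esub> (t \<cdot>\<^bsub>N\<^esub> d) = d"
    using D.rewrite_head[OF t(5), of d] t d by simp
  \<comment> \<open>That \<open>t d\<close> equalizes the image of the pair is tested after composing with \<open>\<sigma>'\<close> at \<open>D Y\<close>,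
    where it becomes the coassociativity of \<open>d\<close>.\<close>
  have "\<sigma>' ?DY \<cdot>\<^bsub>N\<^esub> (ar H (left Y) \<cdot>\<^bsub>N\<^esub> (t \<cdot>\<^bsub>N\<^esub> d))
      = comult D Y \<cdot>\<^bsub>N\<^esub> (\<sigma>' Y \<cdot>\<^bsub>N\<^esub> (t \<cdot>\<^bsub>N\<^esub> d))"
    using D.rewrite_head[OF \<sigma>'_comult[OF d(1)], of "t \<cdot>\<^bsub>N\<^esub> d"] t(1-3) d by simp
  moreover have "\<sigma>' ?DY \<cdot>\<^bsub>N\<^esub> (?HCKd \<cdot>\<^bsub>N\<^esub> (t \<cdot>\<^bsub>N\<^esub> d))
      = ar (Fun D) d \<cdot>\<^bsub>N\<^esub> (\<sigma>' Y \<cdot>\<^bsub>N\<^esub> (t \<cdot>\<^bsub>N\<^esub> d))"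
    using D.rewrite_head[OF \<sigma>'_nat[OF d(2,4)], of "t \<cdot>\<^bsub>N\<^esub> d"] t(1-3) d by simp
  ultimately have same: "\<sigma>' ?DY \<cdot>\<^bsub>N\<^esub> (ar H (left Y) \<cdot>\<^bsub>N\<^esub> (t \<cdot>\<^bsub>N\<^esub> d))
      = \<sigma>' ?DY \<cdot>\<^bsub>N\<^esub> (?HCKd \<cdot>\<^bsub>N\<^esub> (t \<cdot>\<^bsub>N\<^esub> d))"
    unfolding st using coassoc by simp
  have cancel: "t' \<cdot>\<^bsub>N\<^esub> (\<sigma>' ?DY \<cdot>\<^bsub>N\<^esub> l) = l"
    if "l \<in> Arr N" "Cod N l = ob H (ob (Fun C) (ob K ?DY))" for l
    using D.rewrite_head[OF t'(4), of l] t' that d(1) by simp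
  have arrs: "ar H (left Y) \<cdot>\<^bsub>N\<^esub> (t \<cdot>\<^bsub>N\<^esub> d) \<in> Arr N"
      "Cod N (ar H (left Y) \<cdot>\<^bsub>N\<^esub> (t \<cdot>\<^bsub>N\<^esub> d)) = ob H (ob (Fun C) (ob K ?DY))"
      "?HCKd \<cdot>\<^bsub>N\<^esub> (t \<cdot>\<^bsub>N\<^esub> d) \<in> Arr N"
      "Cod N (?HCKd \<cdot>\<^bsub>N\<^esub> (t \<cdot>\<^bsub>N\<^esub> d)) = ob H (ob (Fun C) (ob K ?DY))"
    using t(1-3) d by simp_all
  have equalized: "ar H (left Y) \<cdot>\<^bsub>N\<^esub> (t \<cdot>\<^bsub>N\<^esub> d) = ?HCKd \<cdot>\<^bsub>N\<^esub> (t \<cdot>\<^bsub>N\<^esub> d)"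
    using arg_cong[OF same, of "\<lambda>l. t' \<cdot>\<^bsub>N\<^esub> l"]
    unfolding cancel[OF arrs(1,2)] cancel[OF arrs(3,4)] .
  have td: "t \<cdot>\<^bsub>N\<^esub> d \<in> Arr N" "Cod N (t \<cdot>\<^bsub>N\<^esub> d) = Dom N (ar H (left Y))"
      "Dom N (t \<cdot>\<^bsub>N\<^esub> d) = Y"
    using t(1-3) d by simp_all
  obtain k where k: "k \<in> Arr N" "Dom N k = Dom N (t \<cdot>\<^bsub>N\<^esub> d)" "Cod N k = Dom N ?e"
      "?e \<cdot>\<^bsub>N\<^esub> k = t \<cdot>\<^bsub>N\<^esub> d"
    by (rule D.equalizer_factor[OF e td(1,2) equalized])
  have k': "Dom N k = Y" "Cod N k = ob H (fst (K\<tau> (Y, d)))"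
    using k(2,3) td(3) by simp_all
  have "d \<cdot>\<^bsub>N\<^esub> (cnt (Y, d) \<cdot>\<^bsub>N\<^esub> k) = (\<sigma>' Y \<cdot>\<^bsub>N\<^esub> ?e) \<cdot>\<^bsub>N\<^esub> k"
    by (rule D.rewrite_head[OF coaction_cnt[OF Yd]]) (use d cnt k(1) k' in \<open>simp_all only:\<close>)
  also have "\<dots> = d"
    using k(1,4) k' d(1) st by simp
  finally have dcnt: "d \<cdot>\<^bsub>N\<^esub> (cnt (Y, d) \<cdot>\<^bsub>N\<^esub> k) = d" .
  have ck: "cnt (Y, d) \<cdot>\<^bsub>N\<^esub> k \<in> Arr N" "Cod N (cnt (Y, d) \<cdot>\<^bsub>N\<^esub> k) = Y"
    using D.Comp_Arr[OF k(1) cnt(1)] cnt k' by simp_all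
  have "Ide N Y \<cdot>\<^bsub>N\<^esub> (cnt (Y, d) \<cdot>\<^bsub>N\<^esub> k) = counit D Y \<cdot>\<^bsub>N\<^esub> (d \<cdot>\<^bsub>N\<^esub> (cnt (Y, d) \<cdot>\<^bsub>N\<^esub> k))"
    using D.rewrite_head[OF d_counit, of "cnt (Y, d) \<cdot>\<^bsub>N\<^esub> k"] d ck by simp
  then have right: "cnt (Y, d) \<cdot>\<^bsub>N\<^esub> k = Ide N Y"
    unfolding dcnt d_counit using ck by simp
  have "?e \<cdot>\<^bsub>N\<^esub> (k \<cdot>\<^bsub>N\<^esub> cnt (Y, d)) = (t \<cdot>\<^bsub>N\<^esub> d) \<cdot>\<^bsub>N\<^esub> cnt (Y, d)"
    by (rule D.rewrite_head[OF k(4)]) (use cnt k(1) k' in simp_all)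
  also have "\<dots> = t \<cdot>\<^bsub>N\<^esub> (d \<cdot>\<^bsub>N\<^esub> cnt (Y, d))"
    by (rule D.assoc) (use cnt d t in simp_all)
  also have "\<dots> = ?e"
    unfolding coaction_cnt[OF Yd] using D.rewrite_head[OF t(4), of ?e] t(1-3) d(1) E by simp
  finally have e_kc: "?e \<cdot>\<^bsub>N\<^esub> (k \<cdot>\<^bsub>N\<^esub> cnt (Y, d)) = ?e" .
  have left: "k \<cdot>\<^bsub>N\<^esub> cnt (Y, d) = Ide N (ob H (fst (K\<tau> (Y, d))))"
  proof (rule D.equalizer_mono[OF e])
    show "?e \<cdot>\<^bsub>N\<^esub> (k \<cdot>\<^bsub>N\<^esub> cnt (Y, d)) = ?e \<cdot>\<^bsub>N\<^esub> Ide N (ob H (fst (K\<tau> (Y, d))))"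
      unfolding e_kc using E by simp
  qed (use D.Comp_Arr[OF cnt(1) k(1)] cnt k' E in simp_all)
  show ?thesis
    by (rule D.isoI[where g = k]) (use k(1) k' cnt left right in \<open>simp_all only:\<close>)
qed

theorem lifted_equivalence_iff:
  assumes H_preserves: "preserves_coreflexive_equalizers M N H"
    and H_conservative: "conservative M N H"
  shows "adjoint_equivalence (coalg_cat M C) (coalg_cat N D)
      (H_funct N H \<sigma>) (K_funct M C D K \<tau>)
      (HK_unit M C N D H K \<eta> \<sigma> \<tau>) (HK_counit M C N D H K \<xi> \<sigma> \<tau>)
    \<longleftrightarrow> invertible_trans N N (Fun (conj_comonad N C H K \<eta> \<xi>)) (Fun D) \<sigma>'"
proof
  assume "adjoint_equivalence (coalg_cat M C) (coalg_cat N D)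
      (H_funct N H \<sigma>) (K_funct M C D K \<tau>)
      (HK_unit M C N D H K \<eta> \<sigma> \<tau>) (HK_counit M C N D H K \<xi> \<sigma> \<tau>)"
  then have counit: "is_iso (coalg_cat N D) (HK_counit M C N D H K \<xi> \<sigma> \<tau> q)" if "is_coalg N D q" for q
    using that by (auto simp: adjoint_equivalence_def invertible_trans_iff_iso)
  have "is_iso N (\<sigma>' Y)" if Y: "Y \<in> Obj N" for Y
  proof -
    obtain u where u: "is_iso M u" "Cod M u = fst (K\<tau> (cofree D Y))"
        "cnt (cofree D Y) \<cdot>\<^bsub>N\<^esub> ar H u = \<sigma>' Y"
      using cofree_can_iso[OF Y] .
    have q: "is_coalg N D (ob (Fun D) Y, comult D Y)"
      using D.cofree_coalg[OF Y] by (simp add: cofree_def)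
    have "is_iso N (cnt (cofree D Y))"
      using counit[OF q] D.coalg_iso_iff[OF counit_mor[OF q]]
      unfolding HK_counit_eq[OF q] by (simp add: cofree_def)
    moreover have "u \<in> Arr M" using u(1) by (rule C.isoE)
    then have "Dom N (cnt (cofree D Y)) = Cod N (ar H u)"
      using cnt_arr(2)[OF q] u(2) by (simp add: cofree_def)
    ultimately show ?thesis
      unfolding u(3)[symmetric] using D.iso_Comp functor_iso[OF H_functor u(1)] by blast
  qed
  then show "invertible_trans N N (Fun (conj_comonad N C H K \<eta> \<xi>)) (Fun D) \<sigma>'"
    using conj_trans_nat[OF adj C_comonad D_comonad \<sigma>_trans] by (simp add: invertible_trans_iff_iso)
next
  assume "invertible_trans N N (Fun (conj_comonad N C H K \<eta> \<xi>)) (Fun D) \<sigma>'"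
  then have iso: "is_iso N (\<sigma>' Y)" if "Y \<in> Obj N" for Y
    using that by (auto simp: invertible_trans_iff_iso)
  note cnt_iso = cnt_iso[OF H_preserves iso]
  have "is_iso (coalg_cat N D) (HK_counit M C N D H K \<xi> \<sigma> \<tau> q)" if q: "is_coalg N D q" for q
  proof (cases q)
    case (Pair Y d)
    then have Yd: "is_coalg N D (Y, d)" using q by simp
    show ?thesis
      unfolding Pair HK_counit_eq[OF Yd] D.coalg_iso_iff[OF counit_mor[OF Yd]] by (rule cnt_iso[OF _ Yd])
  qed
  moreover have "is_iso (coalg_cat M C) (HK_unit M C N D H K \<eta> \<sigma> \<tau> p)" if p: "is_coalg M C p" for p
  proof (cases p)
    case (Pair X c)
    then have Xc: "is_coalg M C (X, c)" using p by simp
    let ?q = "(ob H X, \<sigma> X \<cdot>\<^bsub>N\<^esub> ar H c)"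
    have q: "H_ob N H \<sigma> (X, c) = ?q" by (simp add: H_ob_def)
    obtain k where k: "HK_unit M C N D H K \<eta> \<sigma> \<tau> (X, c) = ((X, c), k, K\<tau> ?q)"
      "is_coalg_mor M C ((X, c), k, K\<tau> ?q)" "can ?q \<cdot>\<^bsub>M\<^esub> k = ar (Fun C) (\<eta> X) \<cdot>\<^bsub>M\<^esub> c"
      using unit_mor[OF Xc] unfolding q .
    have k': "k \<in> Arr M" "Cod M k = fst (K\<tau> ?q)"
      using k(2) by (cases "K\<tau> ?q"; simp add: C.is_coalg_mor_iff)+
    note cnt = cnt_arr[OF H_coalg[OF Xc]]
    \<comment> \<open>By a triangle identity \<open>H\<close> of the unit is a right inverse of the invertible counit.\<close>
    have "is_iso N (ar H k)"
    proof (rule D.iso_of_right_inverse[OF cnt_iso[OF _ H_coalg[OF Xc]]])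
      show "cnt ?q \<cdot>\<^bsub>N\<^esub> ar H k = Ide N (Cod N (cnt ?q))"
        unfolding cnt(3) using cnt_unit[OF Xc] k(2,3) unfolding q by blast
    qed (use cnt k' in simp_all)
    then have "is_iso M k"
      using H_conservative k' by (simp add: conservative_def)
    then show ?thesis
      unfolding Pair k(1) C.coalg_iso_iff[OF k(2)] .
  qed
  ultimately show "adjoint_equivalence (coalg_cat M C) (coalg_cat N D)
      (H_funct N H \<sigma>) (K_funct M C D K \<tau>)
      (HK_unit M C N D H K \<eta> \<sigma> \<tau>) (HK_counit M C N D H K \<xi> \<sigma> \<tau>)"
    using lifted_adjunction
    by (auto simp: adjoint_equivalence_def invertible_trans_iff_iso adjunction_def)
qed

end

theorem theorem2p18:
  fixes M :: "('o, 'a) cat" and N :: "('p, 'b) cat"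
    and C :: "('o, 'a) comonad_data" and D :: "('p, 'b) comonad_data"
    and H :: "('o, 'a, 'p, 'b) funct" and K :: "('p, 'b, 'o, 'a) funct"
    and \<eta> :: "'o \<Rightarrow> 'a" and \<xi> :: "'p \<Rightarrow> 'b"
    and \<sigma> :: "'o \<Rightarrow> 'b" and \<tau> :: "'p \<Rightarrow> 'a" and \<sigma>' :: "'p \<Rightarrow> 'b"
  assumes "category M" and "category N"
    and "adjunction M N H K \<eta> \<xi>"
    and "comonad M C" and "comonad N D"
    and "colax_morphism M C N D H \<sigma>"
    and "\<tau> = mate M C D K \<eta> \<xi> \<sigma>"
    and "\<sigma>' = conj_trans N D K \<xi> \<sigma>"
    and "has_coreflexive_equalizers M"
    and "preserves_coreflexive_equalizers M M (Fun C)"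
    and "preserves_coreflexive_equalizers M N H"
    and "conservative M N H"
  shows "adjoint_equivalence (coalg_cat M C) (coalg_cat N D)
           (H_funct N H \<sigma>) (K_funct M C D K \<tau>)
           (HK_unit M C N D H K \<eta> \<sigma> \<tau>) (HK_counit M C N D H K \<xi> \<sigma> \<tau>)
         \<longleftrightarrow> invertible_trans N N (Fun (conj_comonad N C H K \<eta> \<xi>)) (Fun D) \<sigma>'"
proof -
  interpret colax_adjunction_equalizers M N C D H K \<eta> \<xi> \<sigma>
    using assms
    by (simp add: colax_adjunction_equalizers_def colax_adjunction_equalizers_axioms_def
        colax_adjunction_def)
  show ?thesis
    unfolding assms(7,8) by (rule lifted_equivalence_iff[OF assms(11,12)])
qed

end
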